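(* Consider the problem $\min_{x\in\mathbb{R}^n}\{f(x)+\sum_{i=1}^p g_i(x_i) : \sum_{i=1}^p h_i(x_i)=0\}$ under the problem-data assumptions and the initial-point assumption (with constant $C\ge 0$) stated in the context, and let $\epsilon>0$. Define $$\Delta:=\overline{\mathcal P}-\underline{\mathcal P}+\tfrac{C}{2},\qquad \kappa_1:=J_hK_h+M_hL_h,\qquad \kappa_2:=L_h\sqrt{\Delta}+\kappa_1+1 .$$ Choose $\rho\ge\max\{1,L_f,4\Delta\epsilon^{-2}\}$, and let $x^0\in X$ satisfy $\|h(x^0)\|^2\le C/\rho$. Let $\omega\ge 4$, $\theta>1$, $\tau\ge 0$. Then SDD-ADMM with input $(x^0,\rho,\omega,\theta,\tau)$ finds an $\epsilon$-stationary point of the problem in at most $K(\rho)$ iterations (that is, at least one of the iterates $x^0,x^1,\dots,x^{K(\rho)}$ is an $\epsilon$-stationary point), where $$K(\rho):=\left\lceil\frac{2p\,\Delta(\theta+1)^2\kappa_2^2\,\rho}{(\theta-1)\kappa_1\epsilon^2}\right\rceil=\mathcal{O}(\rho\,\epsilon^{-2}).$$ In particular, if $\rho=\Theta(\epsilon^{-2})$ is chosen, then $K(\rho)=\mathcal{O}(\epsilon^{-4})$ (the hidden constants being independent of $\epsilon$ and $\rho$).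
   Context: **Problem data.** $x=[x_1^\top,\dots,x_p^\top]^\top\in\mathbb{R}^n$ with $x_i\in\mathbb{R}^{n_i}$, $\sum_{i=1}^p n_i=n$; $g(x)=\sum_i g_i(x_i)$, $h(x)=\sum_i h_i(x_i)\in\mathbb{R}^m$. Notation $x_{<i},x_{\le i},x_{\geq i},x_{>i}$ refers to the sub-collections of blocks. $\|\cdot\|$ is the Euclidean norm of vectors and the induced norm of matrices; $\mathrm{dist}(z,S)=\inf_{y\in S}\|y-z\|$. **Problem-data assumptions.** (1) Each $g_i:\mathbb{R}^{n_i}\to\mathbb{R}\cup\{+\infty\}$ is proper and lower semicontinuous (possibly nonconvex) with effective domain $X_i=\{x_i\in\mathbb{R}^{n_i}: g_i(x_i)<+\infty\}$; $X=\prod_{i=1}^p X_i$. The proximal problem $\min_{x_i} g_i(x_i)+\frac{\eta}{2}\|x_i-z_i\|^2$ can be solved exactly (a global minimizer exists and is available) for all $z_i\in\mathbb{R}^{n_i}$ and all $\eta\ge L_f$. (2) $f:\mathbb{R}^n\to\mathbb{R}$ satisfies $\|\nabla f(x)-\nabla f(z)\|\le L_f\|x-z\|$ for all $x,z\in X$, with $L_f>0$. (3) Each $h_i:\mathbb{R}^{n_i}\to\mathbb{R}^m$ is continuously differentiable over $X_i$, with $\nabla h_i(x_i)=[\nabla h_{i1}(x_i),\dots,\nabla h_{im}(x_i)]\in\mathbb{R}^{n_i\times m}$, and there are positive constants with, for all $x_i,z_i\in X_i$: $\|h_i(x_i)\|\le M_{h_i}$, $\|h_i(x_i)-h_i(z_i)\|\le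 K_{h_i}\|x_i-z_i\|$, $\|\nabla h_i(x_i)\|\le J_{h_i}$, $\|\nabla h_i(x_i)-\nabla h_i(z_i)\|\le L_{h_i}\|x_i-z_i\|$. Put $M_h=\sum_i M_{h_i}$, $K_h=\max_i K_{h_i}$, $J_h=\max_i J_{h_i}$, $L_h=\max_i L_{h_i}$. (4) $\overline{\mathcal P}:=\sup_{x\in X}f(x)+g(x)<+\infty$ and $\underline{\mathcal P}:=\inf_{x\in X}f(x)+g(x)>-\infty$. **Initial-point assumption.** There is a constant $C\ge0$ such that for every finite $\alpha>0$ one can find $x^0\in X$ with $\|h(x^0)\|^2\le C/\alpha$. **$\epsilon$-stationary point.** $x\in X$ is $\epsilon$-stationary if there is $\lambda\in\mathbb{R}^m$ with $\max_{i}\mathrm{dist}(-\nabla_i f(x)-\nabla h_i(x_i)\lambda,\partial g_i(x_i))\le\epsilon$ and $\|h(x)\|\le\epsilon$, where $\partial g_i$ is the general (limiting) subdifferential of Rockafellar–Wets and $\nabla_i f$ the gradient with respect to block $x_i$. **Algorithm SDD-ADMM.** Let $\mathcal{K}_\rho(x,\mu)=f(x)+\langle\mu,h(x)\rangle+\frac{\rho}{2}\|h(x)\|^2$, $\mathcal{P}(x,\mu)=\mathcal{K}_\rho(x,\mu)+g(x)+\frac{\omega}{2\rho}\|\mu\|^2$, and $\mathrm{Lip}(\mu,\rho)=L_f+\|\mu\|L_h+\rho(J_hK_h+M_hL_h)$. Input: $x^0\in X$, $\rho>0$, $\omega\ge4$, $\theta>1$, $\tau\ge0$; set $\mu^0=0$.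 For $k=0,1,2,\dots$: for $i=1,\dots,p$ in order, let $x_i^{k+1}$ be a global minimizer over $x_i\in\mathbb{R}^{n_i}$ of $$g_i(x_i)+\langle\nabla_{x_i}\mathcal{K}_\rho(x^{k+1}_{<i},x^k_{\ge i},\mu^k),x_i-x_i^k\rangle+\tfrac{\theta\,\mathrm{Lip}(\mu^k,\rho)}{2}\|x_i-x_i^k\|^2;$$ then set $\mu^{k+1}=\arg\min_{\mu}\mathcal{P}(x^{k+1},\mu)+\frac{\tau\omega}{2\rho}\|\mu-\mu^k\|^2=\frac{1}{1+\tau}\left(\tau\mu^k-\omega^{-1}\rho h(x^{k+1})\right)$.
   Formalization: Differentiability and the gradient-Lipschitz bounds (constants L_f, L_{h_i}) are assumed on the convex hulls of X and X_i rather than only on X and X_i; with nonconvex X (e.g. a circle minus a short arc) the literal claim fails. *)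

theory Defs
  imports "HOL-Analysis.Analysis" "HOL-Library.Landau_Symbols"
begin

definition gradient :: "(real^'n \<Rightarrow> real) \<Rightarrow> real^'n \<Rightarrow> real^'n" where
  "gradient F x = (\<chi> j. frechet_derivative F (at x) (axis j 1))"

text \<open>
  In the next four definitions \<open>V\<close> is the linear subspace of the ambient space that plays the role
  of the domain \<open>\<real>^(n_i)\<close> of the extended-valued function \<open>\<phi>\<close>; values of \<open>\<phi>\<close> outside \<open>V\<close>
  are irrelevant.
\<close>

definition proper_on :: "'a set \<Rightarrow> ('a \<Rightarrow> ereal) \<Rightarrow> bool" where
  "proper_on V \<phi> \<longleftrightarrow> (\<forall>x\<in>V. \<phi> x \<noteq> -\<infinity>) \<and> (\<exists>x\<in>V. \<phi> x < \<infinity>)"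

definition lsc_on :: "'a::topological_space set \<Rightarrow> ('a \<Rightarrow> ereal) \<Rightarrow> bool" where
  "lsc_on V \<phi> \<longleftrightarrow> (\<forall>x\<in>V. \<phi> x \<le> Liminf (at x within V) \<phi>)"

definition regular_subdiff :: "'a::real_inner set \<Rightarrow> ('a \<Rightarrow> ereal) \<Rightarrow> 'a \<Rightarrow> 'a set" where
  "regular_subdiff V \<phi> x =
     {v \<in> V. x \<in> V \<and> \<bar>\<phi> x\<bar> \<noteq> \<infinity> \<and>
        0 \<le> Liminf (at x within V)
              (\<lambda>y. (\<phi> y - \<phi> x - ereal (v \<bullet> (y - x))) / ereal (norm (y - x)))}"

definition limiting_subdiff :: "'a::real_inner set \<Rightarrow> ('a \<Rightarrow> ereal) \<Rightarrow> 'a \<Rightarrow> 'a set" where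
  "limiting_subdiff V \<phi> x =
     {v. x \<in> V \<and> \<bar>\<phi> x\<bar> \<noteq> \<infinity> \<and>
        (\<exists>y w. (\<forall>k::nat. w k \<in> regular_subdiff V \<phi> (y k)) \<and>
               y \<longlonglongrightarrow> x \<and> (\<lambda>k. \<phi> (y k)) \<longlonglongrightarrow> \<phi> x \<and> w \<longlonglongrightarrow> v)}"

text \<open>Extended-real distance: unlike \<open>infdist\<close>, it is \<open>\<infinity>\<close> for the empty set.\<close>

definition set_dist :: "'a::real_normed_vector \<Rightarrow> 'a set \<Rightarrow> ereal" where
  "set_dist z S = (INF y\<in>S. ereal (norm (y - z)))"

text \<open>
  The block structure of \<open>\<real>^n\<close> is given by the map \<open>blk\<close> from coordinates to block numbers
  \<open>1, \<dots>, p\<close>. A block vector \<open>x_i \<in> \<real>^(n_i)\<close> is represented by its zero-padded version, an element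
  of the coordinate subspace \<open>blk_space i\<close>; this identification preserves norms and inner products.
  Accordingly \<open>g i\<close> and \<open>h i\<close> matter only on \<open>blk_space i\<close>. The constants \<open>M i\<close>, \<open>K i\<close>, \<open>J i\<close>,
  \<open>L i\<close> bound \<open>h i\<close>, its Lipschitz modulus, its gradient, and the Lipschitz modulus of its gradient.
\<close>

locale sdd_data =
  fixes p :: nat and blk :: "'n::finite \<Rightarrow> nat"
    and f :: "real^'n \<Rightarrow> real"
    and g :: "nat \<Rightarrow> real^'n \<Rightarrow> ereal"
    and h :: "nat \<Rightarrow> real^'n \<Rightarrow> real^('m::finite)"
    and Lf :: real and M K J L :: "nat \<Rightarrow> real" and C :: real
begin

definition blk_space :: "nat \<Rightarrow> (real^'n) set" where
  "blk_space i = {x. \<forall>j. blk j \<noteq> i \<longrightarrow> x $ j = 0}"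

definition blk_proj :: "nat \<Rightarrow> real^'n \<Rightarrow> real^'n" where
  "blk_proj i x = (\<chi> j. if blk j = i then x $ j else 0)"

definition Xi :: "nat \<Rightarrow> (real^'n) set" where
  "Xi i = {x \<in> blk_space i. g i x < \<infinity>}"

definition X :: "(real^'n) set" where
  "X = {x. \<forall>i\<in>{1..p}. blk_proj i x \<in> Xi i}"

definition gsum :: "real^'n \<Rightarrow> ereal" where
  "gsum x = (\<Sum>i=1..p. g i (blk_proj i x))"

definition hsum :: "real^'n \<Rightarrow> real^'m" where
  "hsum x = (\<Sum>i=1..p. h i (blk_proj i x))"

text \<open>
  Precomposing with \<open>blk_proj i\<close> pads the \<open>n_i \<times> m\<close> gradient matrix of \<open>h i\<close> with zero rows.
\<close>

definition grad_h :: "nat \<Rightarrow> real^'n \<Rightarrow> real^'m^'n" where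
  "grad_h i x = transpose (jacobian (\<lambda>y. h i (blk_proj i y)) (at x))"

definition Mh :: real where "Mh = (\<Sum>i=1..p. M i)"
definition Kh :: real where "Kh = Max (K ` {1..p})"
definition Jh :: real where "Jh = Max (J ` {1..p})"
definition Lh :: real where "Lh = Max (L ` {1..p})"

definition P_sup :: ereal where "P_sup = (SUP x\<in>X. ereal (f x) + gsum x)"
definition P_inf :: ereal where "P_inf = (INF x\<in>X. ereal (f x) + gsum x)"

definition eps_stationary :: "real \<Rightarrow> real^'n \<Rightarrow> bool" where
  "eps_stationary \<epsilon> x \<longleftrightarrow> x \<in> X \<and>
     (\<exists>l::real^'m.
        Max ((\<lambda>i. set_dist (- blk_proj i (gradient f x) - grad_h i (blk_proj i x) *v l)
                     (limiting_subdiff (blk_space i) (g i) (blk_proj i x))) ` {1..p}) \<le> ereal \<epsilon> \<and>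
        norm (hsum x) \<le> \<epsilon>)"

definition K_fun :: "real \<Rightarrow> real^'n \<Rightarrow> real^'m \<Rightarrow> real" where
  "K_fun \<rho> x \<mu> = f x + \<mu> \<bullet> hsum x + \<rho> / 2 * (norm (hsum x))\<^sup>2"

definition P_fun :: "real \<Rightarrow> real \<Rightarrow> real^'n \<Rightarrow> real^'m \<Rightarrow> ereal" where
  "P_fun \<rho> \<omega> x \<mu> = ereal (K_fun \<rho> x \<mu>) + gsum x + ereal (\<omega> / (2 * \<rho>) * (norm \<mu>)\<^sup>2)"

definition Lip :: "real^'m \<Rightarrow> real \<Rightarrow> real" where
  "Lip \<mu> \<rho> = Lf + norm \<mu> * Lh + \<rho> * (Jh * Kh + Mh * Lh)"

text \<open>The point \<open>(y_{<i}, x_{\<ge>i})\<close>.\<close>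

definition mixed :: "nat \<Rightarrow> real^'n \<Rightarrow> real^'n \<Rightarrow> real^'n" where
  "mixed i y x = (\<chi> j. if blk j < i then y $ j else x $ j)"

definition sdd_admm ::
  "real^'n \<Rightarrow> real \<Rightarrow> real \<Rightarrow> real \<Rightarrow> real \<Rightarrow> (nat \<Rightarrow> real^'n) \<Rightarrow> (nat \<Rightarrow> real^'m) \<Rightarrow> bool" where
  "sdd_admm x0 \<rho> \<omega> \<theta> \<tau> x \<mu> \<longleftrightarrow> x 0 = x0 \<and> \<mu> 0 = 0 \<and>
     (\<forall>k. (\<forall>i\<in>{1..p}.
             is_arg_min
               (\<lambda>v. g i v + ereal (
                  blk_proj i (gradient (\<lambda>y. K_fun \<rho> y (\<mu> k)) (mixed i (x (Suc k)) (x k)))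
                    \<bullet> (v - blk_proj i (x k))
                  + \<theta> * Lip (\<mu> k) \<rho> / 2 * (norm (v - blk_proj i (x k)))\<^sup>2))
               (\<lambda>v. v \<in> blk_space i)
               (blk_proj i (x (Suc k)))) \<and>
          is_arg_min
            (\<lambda>\<nu>. P_fun \<rho> \<omega> (x (Suc k)) \<nu> + ereal (\<tau> * \<omega> / (2 * \<rho>) * (norm (\<nu> - \<mu> k))\<^sup>2))
            (\<lambda>\<nu>. True)
            (\<mu> (Suc k)))"

text \<open>The multiplier step of \<open>sdd_admm\<close> has the usual closed form.\<close>

lemma is_arg_min_multiplier_iff:
  fixes m \<nu>' :: "real^'m"
  assumes fin: "\<bar>gsum x\<bar> \<noteq> \<infinity>" and pos: "\<rho> > 0" "\<omega> > 0" "\<tau> \<ge> 0"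
  shows "is_arg_min
           (\<lambda>\<nu>. P_fun \<rho> \<omega> x \<nu> + ereal (\<tau> * \<omega> / (2 * \<rho>) * (norm (\<nu> - m))\<^sup>2)) (\<lambda>\<nu>. True) \<nu>' \<longleftrightarrow>
         \<nu>' = (1 / (1 + \<tau>)) *\<^sub>R (\<tau> *\<^sub>R m - (\<rho> / \<omega>) *\<^sub>R hsum x)"
proof -
  obtain r where r: "gsum x = ereal r"
    using fin by (cases "gsum x") auto
  define H where "H = hsum x"
  define n0 where "n0 = (1 / (1 + \<tau>)) *\<^sub>R (\<tau> *\<^sub>R m - (\<rho> / \<omega>) *\<^sub>R H)"
  define q where "q \<nu> = K_fun \<rho> x \<nu> + r + \<omega> / (2 * \<rho>) * (norm \<nu>)\<^sup>2
                          + \<tau> * \<omega> / (2 * \<rho>) * (norm (\<nu> - m))\<^sup>2" for \<nu>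
  have q: "P_fun \<rho> \<omega> x \<nu> + ereal (\<tau> * \<omega> / (2 * \<rho>) * (norm (\<nu> - m))\<^sup>2) = ereal (q \<nu>)" for \<nu>
    by (simp add: P_fun_def r q_def)
  have "(1 + \<tau>) *\<^sub>R n0 = \<tau> *\<^sub>R m - (\<rho> / \<omega>) *\<^sub>R H"
    using pos by (simp add: n0_def)
  then have "(\<rho> / \<omega>) *\<^sub>R H = \<tau> *\<^sub>R m - (1 + \<tau>) *\<^sub>R n0"
    by (simp add: algebra_simps)
  then have "(\<omega> / \<rho>) *\<^sub>R ((\<rho> / \<omega>) *\<^sub>R H) = (\<omega> / \<rho>) *\<^sub>R (\<tau> *\<^sub>R m - (1 + \<tau>) *\<^sub>R n0)"
    by simp
  then have H: "H = (\<omega> / \<rho>) *\<^sub>R (\<tau> *\<^sub>R m - (1 + \<tau>) *\<^sub>R n0)"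
    using pos by simp
  define a where "a = \<omega> / \<rho>"
  have inH: "u \<bullet> H = a * (\<tau> * (u \<bullet> m) - (1 + \<tau>) * (u \<bullet> n0))" for u
    unfolding H a_def by (simp only: inner_scaleR_right inner_diff_right)
  have a: "\<omega> / (2 * \<rho>) = a / 2" "\<tau> * \<omega> / (2 * \<rho>) = \<tau> * a / 2"
      "(1 + \<tau>) * \<omega> / (2 * \<rho>) = (1 + \<tau>) * a / 2"
    by (simp_all add: a_def)
  have key: "q \<nu> = q n0 + (1 + \<tau>) * \<omega> / (2 * \<rho>) * (norm (\<nu> - n0))\<^sup>2" for \<nu>
  proof -
    have sq: "(norm (u - w))\<^sup>2 = u \<bullet> u - 2 * (u \<bullet> w) + w \<bullet> w" for u w :: "real^'m"
      by (simp add: power2_norm_eq_inner inner_diff_left inner_diff_right inner_commute)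
    have sq0: "(norm u)\<^sup>2 = u \<bullet> u" for u :: "real^'m"
      by (rule power2_norm_eq_inner)
    have arith: "a * (\<tau> * A - (1 + \<tau>) * B) + a / 2 * N + \<tau> * a / 2 * (N - 2 * A + D) =
        a * (\<tau> * E - (1 + \<tau>) * F) + a / 2 * F + \<tau> * a / 2 * (F - 2 * E + D)
        + (1 + \<tau>) * a / 2 * (N - 2 * B + F)" for A B N D E F
      by (simp add: field_simps)
    show ?thesis
      using arith[of "\<nu> \<bullet> m" "\<nu> \<bullet> n0" "\<nu> \<bullet> \<nu>" "m \<bullet> m" "n0 \<bullet> m" "n0 \<bullet> n0"]
      unfolding q_def K_fun_def H_def[symmetric] a sq
      unfolding inH[of \<nu>] inH[of n0] sq0[of \<nu>] sq0[of n0] by linarith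
  qed
  have ge: "q n0 \<le> q \<nu>" for \<nu>
    unfolding key[of \<nu>] using pos by simp
  have gt: "q n0 < q \<nu>" if "\<nu> \<noteq> n0" for \<nu>
    unfolding key[of \<nu>] using pos that by simp
  have "is_arg_min (\<lambda>\<nu>. ereal (q \<nu>)) (\<lambda>\<nu>. True) \<nu>' \<longleftrightarrow> \<nu>' = n0"
    unfolding is_arg_min_def less_ereal.simps by (metis ge gt not_le)
  then show ?thesis
    unfolding q n0_def H_def .
qed

definition Delta :: real where
  "Delta = real_of_ereal (P_sup - P_inf) + C / 2"

definition kappa1 :: real where
  "kappa1 = Jh * Kh + Mh * Lh"

definition kappa2 :: real where
  "kappa2 = Lh * sqrt Delta + kappa1 + 1"

definition rho_min :: "real \<Rightarrow> real" where
  "rho_min \<epsilon> = Max {1, Lf, 4 * Delta / \<epsilon>\<^sup>2}"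

definition iter_bound :: "real \<Rightarrow> real \<Rightarrow> real \<Rightarrow> nat" where
  "iter_bound \<theta> \<epsilon> \<rho> =
     nat \<lceil>2 * real p * Delta * (\<theta> + 1)\<^sup>2 * kappa2\<^sup>2 * \<rho> / ((\<theta> - 1) * kappa1 * \<epsilon>\<^sup>2)\<rceil>"

end

text \<open>
  The differentiability and gradient-Lipschitz conditions are imposed on the convex hulls of \<open>X\<close> and
  \<open>X_i\<close>, all other bounds on \<open>X_i\<close> itself. The domains may be nonconvex, and the descent lemma
  behind the method needs the gradient bounds along segments between points of \<open>X\<close>. With these bounds
  required only on \<open>X\<close> the complexity bound is false: let \<open>X\<close> be the unit circle minus a short open
  arc, \<open>g\<close> its indicator function, \<open>h = 0\<close>, and \<open>f\<close> a smooth function equal to minus the polar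
  angle on a neighbourhood of \<open>X\<close>; the iterates can jump over the arc and circulate forever.
\<close>

locale sdd_problem = sdd_data p blk f g h Lf M K J L C
  for p :: nat and blk :: "'n::finite \<Rightarrow> nat"
    and f :: "real^'n \<Rightarrow> real"
    and g :: "nat \<Rightarrow> real^'n \<Rightarrow> ereal"
    and h :: "nat \<Rightarrow> real^'n \<Rightarrow> real^('m::finite)"
    and Lf :: real and M K J L :: "nat \<Rightarrow> real" and C :: real +
  assumes blocks: "range blk = {1..p}"
    and g_proper: "\<And>i. i \<in> {1..p} \<Longrightarrow> proper_on (blk_space i) (g i)"
    and g_lsc: "\<And>i. i \<in> {1..p} \<Longrightarrow> lsc_on (blk_space i) (g i)"
    and g_prox: "\<And>i z \<eta>. i \<in> {1..p} \<Longrightarrow> z \<in> blk_space i \<Longrightarrow> \<eta> \<ge> Lf \<Longrightarrow>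
       \<exists>v. is_arg_min (\<lambda>v. g i v + ereal (\<eta> / 2 * (norm (v - z))\<^sup>2)) (\<lambda>v. v \<in> blk_space i) v"
    and Lf_pos: "Lf > 0"
    and f_diff: "\<And>x. x \<in> convex hull X \<Longrightarrow> f differentiable (at x)"
    and f_grad_lipschitz: "\<And>x z. x \<in> convex hull X \<Longrightarrow> z \<in> convex hull X \<Longrightarrow>
       norm (gradient f x - gradient f z) \<le> Lf * norm (x - z)"
    and const_pos: "\<And>i. i \<in> {1..p} \<Longrightarrow> M i > 0 \<and> K i > 0 \<and> J i > 0 \<and> L i > 0"
    and h_diff: "\<And>i x. i \<in> {1..p} \<Longrightarrow> x \<in> convex hull (Xi i) \<Longrightarrow>
       (\<lambda>y. h i (blk_proj i y)) differentiable (at x)"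
    and h_grad_cont: "\<And>i. i \<in> {1..p} \<Longrightarrow> continuous_on (Xi i) (grad_h i)"
    and h_bound: "\<And>i x. i \<in> {1..p} \<Longrightarrow> x \<in> Xi i \<Longrightarrow> norm (h i x) \<le> M i"
    and h_lipschitz: "\<And>i x z. i \<in> {1..p} \<Longrightarrow> x \<in> Xi i \<Longrightarrow> z \<in> Xi i \<Longrightarrow>
       norm (h i x - h i z) \<le> K i * norm (x - z)"
    and h_grad_bound: "\<And>i x. i \<in> {1..p} \<Longrightarrow> x \<in> Xi i \<Longrightarrow> onorm ((*v) (grad_h i x)) \<le> J i"
    and h_grad_lipschitz: "\<And>i x z. i \<in> {1..p} \<Longrightarrow>
       x \<in> convex hull (Xi i) \<Longrightarrow> z \<in> convex hull (Xi i) \<Longrightarrow>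
       onorm ((*v) (grad_h i x - grad_h i z)) \<le> L i * norm (x - z)"
    and P_sup_finite: "P_sup < \<infinity>"
    and P_inf_finite: "P_inf > -\<infinity>"
    and C_nonneg: "C \<ge> 0"
    and initial_point: "\<And>\<alpha>::real. \<alpha> > 0 \<Longrightarrow> \<exists>x0\<in>X. (norm (hsum x0))\<^sup>2 \<le> C / \<alpha>"

end

theory Submission
  imports Defs
begin

text \<open>
  The function \<open>\<P>(x, \<mu>)\<close> is a Lyapunov function. Each block step lowers it by at least
  \<open>(\<theta> - 1) \<rho> \<kappa>\<^sub>1 / 2\<close> times the squared step length, because \<open>Lip \<mu> \<rho>\<close> is a descent constant for the
  linearised smooth part, and the multiplier step does not increase it. It starts below
  \<open>P_sup + C / 2\<close> and, since \<open>\<omega> \<ge> 4\<close>, completing the square gives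
  \<open>\<P>(x, \<mu>) \<ge> P_inf + \<rho> / 4 \<parallel>h(x)\<parallel>\<^sup>2 + \<parallel>\<mu>\<parallel>\<^sup>2 / \<rho>\<close>. Hence along the whole run \<open>\<parallel>h\<parallel>\<^sup>2 \<le> 4 \<Delta> / \<rho> \<le> \<epsilon>\<^sup>2\<close> and
  \<open>\<parallel>\<mu>\<parallel>\<^sup>2 \<le> \<rho> \<Delta>\<close>, so \<open>Lip \<mu> \<rho> \<le> \<rho> \<kappa>\<^sub>2\<close>, and the squared steps sum to at most
  \<open>2 \<Delta> / ((\<theta> - 1) \<rho> \<kappa>\<^sub>1)\<close>. The optimality condition of the block subproblems, with multiplier
  \<open>\<mu>\<^sup>k + \<rho> h(x\<^sup>k\<^sup>+\<^sup>1)\<close>, bounds the stationarity residual of \<open>x\<^sup>k\<^sup>+\<^sup>1\<close> by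
  \<open>\<surd>p (\<theta> + 1) \<rho> \<kappa>\<^sub>2\<close> times the step length, so one of the first \<open>K(\<rho>)\<close> steps is short enough.
  If \<open>K(\<rho>) = 0\<close> then \<open>\<Delta> = 0\<close> and the first step does not move.
\<close>

section \<open>Derivatives and quadratic bounds\<close>

lemma has_derivative_gradient:
  fixes F :: "real^'n \<Rightarrow> real"
  assumes "F differentiable (at x)"
  shows "(F has_derivative (\<lambda>d. gradient F x \<bullet> d)) (at x)"
proof -
  let ?D = "frechet_derivative F (at x)"
  have D: "(F has_derivative ?D) (at x)"
    using assms by (simp add: frechet_derivative_works)
  then have lin: "linear ?D"
    by (rule has_derivative_linear)
  have "?D d = gradient F x \<bullet> d" for d
  proof -
    have "?D d = ?D (\<Sum>j\<in>UNIV. (d $ j) *\<^sub>R axis j 1)"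
      by (simp add: basis_expansion flip: scalar_mult_eq_scaleR)
    also have "\<dots> = (\<Sum>j\<in>UNIV. d $ j * ?D (axis j 1))"
      by (simp add: linear_sum[OF lin] linear_cmul[OF lin])
    finally show ?thesis
      by (simp add: gradient_def inner_vec_def mult.commute)
  qed
  then have "?D = (\<lambda>d. gradient F x \<bullet> d)" ..
  with D show ?thesis by simp
qed

lemma has_derivative_imp_gradient_inner:
  fixes F :: "real^'n \<Rightarrow> real"
  assumes "(F has_derivative D) (at x)"
  shows "gradient F x \<bullet> d = D d"
proof -
  have "F differentiable (at x)"
    using assms by (rule differentiableI)
  then have "(\<lambda>d. gradient F x \<bullet> d) = D"
    using has_derivative_gradient has_derivative_unique assms by blast
  then show ?thesis by metis
qed

text \<open>Testing the remainder \<open>w\<close> against itself reduces the vector-valued case to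
  a monotone real function on the unit interval, so one argument serves both the real
  \<open>f\<close> and the vector-valued \<open>h i\<close>.\<close>

lemma taylor_remainder_le_half:
  fixes E :: "'a::real_normed_vector \<Rightarrow> 'b::real_inner"
  assumes D: "\<And>t. t \<in> {0..1} \<Longrightarrow> (E has_derivative D t) (at (x + t *\<^sub>R d))"
    and c: "\<And>t. t \<in> {0..1} \<Longrightarrow> norm (D t d - D 0 d) \<le> c * t"
  shows "norm (E (x + d) - E x - D 0 d) \<le> c / 2"
proof -
  define w where "w = E (x + d) - E x - D 0 d"
  \<comment> \<open>The subtracted square has derivative \<open>norm w * c * t\<close>, which
    dominates the change of the derivative allowed by the second hypothesis. Hence
    \<open>\<psi>\<close> is nonincreasing, and the factor 1/2 appears at
    \<open>t = 1\<close>.\<close>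
  define \<psi> where "\<psi> t = w \<bullet> (E (x + t *\<^sub>R d) - t *\<^sub>R D 0 d) - norm w * c * t\<^sup>2 / 2" for t
  have der: "\<exists>y. (\<psi> has_real_derivative y) (at t) \<and> y \<le> 0" if "0 \<le> t" "t \<le> 1" for t
  proof (intro exI conjI)
    have t: "t \<in> {0..1}" using that by simp
    have lin: "linear (D t)"
      using D[OF t] by (rule has_derivative_linear)
    have "((\<lambda>s. E (x + s *\<^sub>R d)) has_derivative (\<lambda>s. D t (s *\<^sub>R d))) (at t)"
      using D[OF t] by (auto intro!: has_derivative_compose[of "\<lambda>s. x + s *\<^sub>R d" _ t UNIV E] derivative_eq_intros)
    then have "((\<lambda>s. E (x + s *\<^sub>R d)) has_vector_derivative D t d) (at t)"
      unfolding has_vector_derivative_def by (simp add: linear_cmul[OF lin])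
    then have "((\<lambda>s. E (x + s *\<^sub>R d) - s *\<^sub>R D 0 d) has_vector_derivative (D t d - D 0 d)) (at t)"
      by (auto intro!: derivative_eq_intros)
    then have "((\<lambda>s. w \<bullet> (E (x + s *\<^sub>R d) - s *\<^sub>R D 0 d)) has_real_derivative w \<bullet> (D t d - D 0 d)) (at t)"
      unfolding has_vector_derivative_def has_field_derivative_def
      using has_derivative_inner_right[of _ _ _ w] by (fastforce simp: mult.commute[of _ "w \<bullet> _"])
    then show "(\<psi> has_real_derivative (w \<bullet> (D t d - D 0 d) - norm w * c * t)) (at t)"
      unfolding \<psi>_def by (auto intro!: derivative_eq_intros)
    have "w \<bullet> (D t d - D 0 d) \<le> norm w * norm (D t d - D 0 d)"
      by (rule norm_cauchy_schwarz)
    also have "\<dots> \<le> norm w * (c * t)"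
      using c[OF t] by (simp add: mult_left_mono)
    finally show "w \<bullet> (D t d - D 0 d) - norm w * c * t \<le> 0"
      by (simp add: mult.assoc)
  qed
  have "\<psi> 1 \<le> \<psi> 0"
    using DERIV_nonpos_imp_nonincreasing[of 0 1 \<psi>] der by simp
  then have "w \<bullet> w \<le> norm w * (c / 2)"
    by (simp add: \<psi>_def w_def inner_diff_right)
  then have *: "norm w * norm w \<le> norm w * (c / 2)"
    by (simp add: power2_norm_eq_inner flip: power2_eq_square)
  \<comment> \<open>Read off at \<open>t = 1\<close>; it settles the case \<open>w = 0\<close>,
    where \<open>norm w\<close> cannot be cancelled.\<close>
  have "0 \<le> c"
    using order_trans[OF norm_ge_zero c[of 1]] by simp
  then have "norm w \<le> c / 2"
    using * by (cases "w = 0") (auto simp: mult_le_cancel_left)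
  then show ?thesis by (simp add: w_def)
qed

text \<open>Testing \<open>w\<close> against itself moves the transpose to the other side of the
  inner product. The problem data bound the gradient matrices, whereas derivatives act through their
  transposes.\<close>

lemma norm_transpose_mult_le:
  fixes G :: "real^'m^'n"
  assumes "onorm ((*v) G) \<le> c"
  shows "norm (transpose G *v d) \<le> c * norm d"
proof -
  define w where "w = transpose G *v d"
  have "w \<bullet> w = d \<bullet> (G *v w)"
    unfolding w_def by (metis dot_lmul_matrix transpose_matrix_vector)
  also have "\<dots> \<le> norm d * norm (G *v w)"
    by (rule norm_cauchy_schwarz)
  also have "\<dots> \<le> norm d * (c * norm w)"
  proof (rule mult_left_mono)
    have "norm (G *v w) \<le> onorm ((*v) G) * norm w"
      by (rule onorm) (rule matrix_vector_mul_bounded_linear)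
    also have "\<dots> \<le> c * norm w"
      using assms by (simp add: mult_right_mono)
    finally show "norm (G *v w) \<le> c * norm w" .
  qed simp
  finally have "norm w * norm w \<le> (c * norm d) * norm w"
    by (simp add: mult_ac power2_norm_eq_inner flip: power2_eq_square)
  moreover have "0 \<le> c"
    using assms onorm_pos_le[OF matrix_vector_mul_bounded_linear, of G] by linarith
  ultimately have "norm w \<le> c * norm d"
    by (cases "w = 0") (auto simp: mult_le_cancel_right)
  then show ?thesis by (simp add: w_def)
qed

lemma transpose_mult_diff:
  fixes A B :: "real^'m^'n"
  shows "transpose (A - B) *v d = transpose A *v d - transpose B *v d"
  by (simp add: transpose_def matrix_vector_mult_def vec_eq_iff algebra_simps sum_subtractf del: transpose_matrix_vector)

section \<open>Subgradients at minimizers of proximal models\<close>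

text \<open>Expanding the square around \<open>u\<close> turns global minimality into a quadratic
  minorant of \<open>\<phi>\<close> on \<open>V\<close> with slope \<open>v\<close> and error
  \<open>\<eta> / 2\<close> times the squared distance. The difference quotients are therefore
  bounded below by a function tending to 0.\<close>

lemma regular_subdiff_of_prox_min:
  fixes \<phi> :: "'a::real_inner \<Rightarrow> ereal"
  assumes V: "subspace V"
    and min: "is_arg_min (\<lambda>v. \<phi> v + ereal (G \<bullet> (v - z) + \<eta> / 2 * (norm (v - z))\<^sup>2)) (\<lambda>v. v \<in> V) u"
    and fin: "\<bar>\<phi> u\<bar> \<noteq> \<infinity>"
    and G: "G \<in> V" and z: "z \<in> V"
  shows "- G - \<eta> *\<^sub>R (u - z) \<in> regular_subdiff V \<phi> u"
proof -
  define v where "v = - G - \<eta> *\<^sub>R (u - z)"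
  have u: "u \<in> V" using min by (simp add: is_arg_min_def)
  obtain r where r: "\<phi> u = ereal r" using fin by (cases "\<phi> u") auto
  have lower: "ereal (- (\<eta> / 2) * norm (y - u))
      \<le> (\<phi> y - \<phi> u - ereal (v \<bullet> (y - u))) / ereal (norm (y - u))" if y: "y \<in> V" "y \<noteq> u" for y
  proof -
    have n: "norm (y - u) > 0" using y by simp
    have "\<not> \<phi> y + ereal (G \<bullet> (y - z) + \<eta> / 2 * (norm (y - z))\<^sup>2)
          < \<phi> u + ereal (G \<bullet> (u - z) + \<eta> / 2 * (norm (u - z))\<^sup>2)"
      using min y unfolding is_arg_min_def by blast
    moreover have "(norm (y - z))\<^sup>2 = (norm (y - u))\<^sup>2 + 2 * ((y - u) \<bullet> (u - z)) + (norm (u - z))\<^sup>2"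
      unfolding power2_norm_eq_inner by (simp add: algebra_simps inner_commute)
    moreover have "v \<bullet> (y - u) = - (G \<bullet> (y - z)) + G \<bullet> (u - z) - \<eta> * ((y - u) \<bullet> (u - z))"
      unfolding v_def by (simp add: algebra_simps inner_commute)
    ultimately have ge: "\<phi> y \<ge> ereal (r + v \<bullet> (y - u) - \<eta> / 2 * (norm (y - u))\<^sup>2)"
      unfolding r by (cases "\<phi> y") (auto simp: algebra_simps)
    show ?thesis
    proof (cases "\<phi> y")
      case (real s)
      then have "- (\<eta> / 2) * norm (y - u) * norm (y - u) \<le> s - r - v \<bullet> (y - u)"
        using ge by (simp add: power2_eq_square)
      then have "- (\<eta> / 2) * norm (y - u) \<le> (s - r - v \<bullet> (y - u)) / norm (y - u)"
        using n by (simp add: pos_le_divide_eq)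
      then show ?thesis using real r n by simp
    next
      case PInf
      then show ?thesis using r n by simp
    next
      case MInf
      then show ?thesis using ge by simp
    qed
  qed
  have "((\<lambda>y. - (\<eta> / 2) * norm (y - u)) \<longlongrightarrow> - (\<eta> / 2) * norm (u - u)) (at u within V)"
    by (intro tendsto_intros)
  then have "((\<lambda>y. ereal (- (\<eta> / 2) * norm (y - u))) \<longlongrightarrow> ereal 0) (at u within V)"
    by (intro tendsto_ereal) simp
  \<comment> \<open>The filter is \<open>bot\<close> exactly when \<open>V\<close> is trivial, and
    the lower limit is then infinite.\<close>
  then have "0 \<le> Liminf (at u within V) (\<lambda>y. ereal (- (\<eta> / 2) * norm (y - u)))"
    by (cases "at u within V = bot") (simp, metis lim_imp_Liminf zero_ereal_def order_refl)
  also have "\<dots> \<le> Liminf (at u within V)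
      (\<lambda>y. (\<phi> y - \<phi> u - ereal (v \<bullet> (y - u))) / ereal (norm (y - u)))"
    by (rule Liminf_mono) (use lower in \<open>auto simp: eventually_at_filter\<close>)
  finally have "0 \<le> Liminf (at u within V)
      (\<lambda>y. (\<phi> y - \<phi> u - ereal (v \<bullet> (y - u))) / ereal (norm (y - u)))" .
  moreover have "v \<in> V"
    unfolding v_def using V G u z by (intro subspace_diff subspace_scale subspace_neg)
  ultimately show ?thesis
    unfolding regular_subdiff_def v_def[symmetric] using u fin by simp
qed

text \<open>Constant sequences are the witnesses.\<close>

lemma regular_subdiff_subset_limiting: "regular_subdiff V \<phi> x \<subseteq> limiting_subdiff V \<phi> x"
proof
  fix v assume "v \<in> regular_subdiff V \<phi> x"
  then show "v \<in> limiting_subdiff V \<phi> x"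
    unfolding limiting_subdiff_def
    by (intro CollectI conjI exI[of _ "\<lambda>_. x"] exI[of _ "\<lambda>_. v"]) (auto simp: regular_subdiff_def)
qed


section \<open>Block projections\<close>

context sdd_data
begin

lemma linear_blk_proj: "linear (blk_proj i)"
  by (rule linearI) (auto simp: blk_proj_def vec_eq_iff)

lemmas blk_proj_add = linear_add[OF linear_blk_proj]
  and blk_proj_diff = linear_diff[OF linear_blk_proj]
  and blk_proj_scaleR = linear_cmul[OF linear_blk_proj]

lemma subspace_blk_space: "subspace (blk_space i)"
  by (auto simp: subspace_def blk_space_def)

lemma blk_proj_in [simp]: "blk_proj i x \<in> blk_space i"
  by (simp add: blk_proj_def blk_space_def)

lemma blk_proj_blk_proj: "blk_proj i (blk_proj j x) = (if i = j then blk_proj i x else 0)"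
  by (auto simp: blk_proj_def vec_eq_iff)

lemma blk_proj_idem [simp]: "blk_proj i (blk_proj i x) = blk_proj i x"
  by (simp add: blk_proj_blk_proj)

lemma blk_proj_inner: "blk_proj i x \<bullet> y = x \<bullet> blk_proj i y"
  by (auto simp: blk_proj_def inner_vec_def intro!: sum.cong)

lemma norm_blk_proj_le: "norm (blk_proj i x) \<le> norm x"
  by (rule norm_le_componentwise_cart) (simp add: blk_proj_def)

lemma blk_proj_mixed: "blk_proj j (mixed i y x) = (if j < i then blk_proj j y else blk_proj j x)"
  by (auto simp: blk_proj_def mixed_def vec_eq_iff)

text \<open>Advancing by one block changes that block alone, which lets block estimates telescope
  over a sweep.\<close>

lemma mixed_Suc: "mixed (Suc i) y x = mixed i y x + blk_proj i (y - x)"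
  by (auto simp: blk_proj_def mixed_def vec_eq_iff)

lemma norm_mixed_diff_le: "norm (mixed i y x - y) \<le> norm (y - x)"
  by (rule norm_le_componentwise_cart) (auto simp: mixed_def)

lemma X_D: "x \<in> X \<Longrightarrow> i \<in> {1..p} \<Longrightarrow> blk_proj i x \<in> Xi i"
  by (simp add: X_def)

text \<open>\<open>X\<close> is a product over the blocks, so exchanging whole blocks between
  feasible points preserves feasibility.\<close>

lemma mixed_in_X: "x \<in> X \<Longrightarrow> y \<in> X \<Longrightarrow> mixed i y x \<in> X"
  by (auto simp: X_def blk_proj_mixed)

end

section \<open>Norms of blocks and positivity of the constants\<close>

context sdd_problem
begin

lemma blk_range: "1 \<le> blk j" "blk j \<le> p"
  using blocks by (metis atLeastAtMost_iff rangeI)+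

lemma p_pos: "1 \<le> p"
  using blk_range[of undefined] by linarith

lemma sum_blk_proj: "(\<Sum>i=1..p. blk_proj i x) = x"
  by (simp add: vec_eq_iff blk_proj_def blk_range[unfolded One_nat_def])

lemma sum_norm_blk_proj_sq: "(\<Sum>i=1..p. (norm (blk_proj i x))\<^sup>2) = (norm x)\<^sup>2"
proof -
  have "(norm (blk_proj i x))\<^sup>2 = x \<bullet> blk_proj i x" for i
    by (simp add: power2_norm_eq_inner blk_proj_inner)
  then show ?thesis
    by (simp only: sum_blk_proj power2_norm_eq_inner flip: inner_sum_right)
qed

text \<open>Cauchy-Schwarz over the \<open>p\<close> blocks. This is the origin of
  \<open>sqrt p\<close> in the residual bound, and so of the factor \<open>p\<close> in the
  iteration bound.\<close>

lemma sum_norm_blk_proj_le: "(\<Sum>i=1..p. norm (blk_proj i x)) \<le> sqrt p * norm x"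
proof -
  have "(\<Sum>i=1..p. norm (blk_proj i x))\<^sup>2 \<le> (norm x)\<^sup>2 * p"
    using sum_squared_le_sum_of_squares[of "\<lambda>i. norm (blk_proj i x)" "{1..p}"]
    by (simp only: sum_norm_blk_proj_sq card_atLeastAtMost) simp
  then have "(\<Sum>i=1..p. norm (blk_proj i x)) \<le> sqrt ((norm x)\<^sup>2 * p)"
    by (rule real_le_rsqrt)
  then show ?thesis
    by (simp add: real_sqrt_mult mult.commute)
qed

lemma mixed_first: "mixed 1 y x = x"
proof -
  have "\<not> blk j < 1" for j
    using blk_range(1)[of j] by linarith
  then show ?thesis
    by (simp only: mixed_def vec_eq_iff vec_lambda_beta if_False simp_thms)
qed

lemma mixed_last: "mixed (Suc p) y x = y"
  using blk_range by (auto simp: mixed_def vec_eq_iff less_Suc_eq_le)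

lemma Max_consts:
  assumes "i \<in> {1..p}"
  shows "K i \<le> Kh" "J i \<le> Jh" "L i \<le> Lh"
  unfolding Kh_def Jh_def Lh_def using assms by (auto intro: Max_ge)

lemma consts_pos: "0 < Kh" "0 < Jh" "0 < Lh" "0 < Mh"
proof -
  have 1: "1 \<in> {1..p}" using p_pos by simp
  show "0 < Kh" "0 < Jh" "0 < Lh"
    using Max_consts[OF 1] const_pos[OF 1] by linarith+
  show "0 < Mh"
    unfolding Mh_def by (rule sum_pos) (use const_pos 1 in auto)
qed

lemma kappa1_pos: "0 < kappa1"
  unfolding kappa1_def using consts_pos by (simp add: add_pos_pos)

section \<open>The smooth part\<close>

abbreviation jac :: "nat \<Rightarrow> real^'n \<Rightarrow> real^'n \<Rightarrow> real^'m" where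
  "jac i x d \<equiv> transpose (grad_h i (blk_proj i x)) *v d"

text \<open>Differentiability is given at zero-padded block points. Since \<open>blk_proj i\<close>
  is idempotent, the chain rule carries the derivative to every point with the same block, and
  uniqueness of the derivative shows that it ignores the other blocks.\<close>

lemma has_derivative_h:
  assumes i: "i \<in> {1..p}" and x: "blk_proj i x \<in> convex hull Xi i"
  shows "((\<lambda>y. h i (blk_proj i y)) has_derivative jac i x) (at x)"
    and "jac i x (blk_proj i d) = jac i x d"
proof -
  let ?H = "\<lambda>y. h i (blk_proj i y)"
  have D: "(?H has_derivative jac i x) (at (blk_proj i x))"
    using h_diff[OF i x] by (simp add: grad_h_def jacobian_works)
  have P: "(blk_proj i has_derivative blk_proj i) (at z)" for z
    by (rule linear_imp_has_derivative[OF linear_blk_proj])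
  have *: "(?H has_derivative (\<lambda>d. jac i x (blk_proj i d))) (at z)"
    if "blk_proj i z = blk_proj i x" for z
    using has_derivative_compose[OF P, of ?H "jac i x" z] D that by simp
  have "jac i x = (\<lambda>d. jac i x (blk_proj i d))"
    using D *[of "blk_proj i x"] by (rule has_derivative_unique) simp
  then show "jac i x (blk_proj i d) = jac i x d" for d
    by metis
  then show "(?H has_derivative jac i x) (at x)"
    using *[of x] by simp
qed

lemma inner_grad_h: "(grad_h i (blk_proj i x) *v u) \<bullet> d = u \<bullet> jac i x d"
  by (metis dot_lmul_matrix inner_commute transpose_matrix_vector transpose_transpose)

text \<open>The segment between the two block points stays in the convex hull of
  \<open>Xi i\<close>, where the gradient is Lipschitz. The Taylor constant is \<open>Lh\<close>
  times the squared step: one factor measures the change of the gradient, the other is the direction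
  it acts on. \<open>f_remainder\<close> is obtained in the same way.\<close>

lemma h_remainder:
  assumes i: "i \<in> {1..p}" and x: "blk_proj i x \<in> Xi i" "blk_proj i y \<in> Xi i"
  shows "norm (h i (blk_proj i y) - h i (blk_proj i x) - jac i x (blk_proj i (y - x)))
           \<le> Lh * (norm (blk_proj i (y - x)))\<^sup>2 / 2"
proof -
  define d where "d = blk_proj i (y - x)"
  define u where "u = blk_proj i x"
  have [simp]: "blk_proj i d = d" "blk_proj i u = u"
    by (simp_all add: d_def u_def)
  have seg: "u + t *\<^sub>R d \<in> convex hull Xi i" if "t \<in> {0..1}" for t
  proof -
    have "(1 - t) *\<^sub>R blk_proj i x + t *\<^sub>R blk_proj i y \<in> convex hull Xi i"
      using that x by (intro convexD[OF convex_convex_hull] hull_inc) auto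
    then show ?thesis
      by (simp add: u_def d_def blk_proj_diff algebra_simps)
  qed
  have "norm (h i (blk_proj i (u + d)) - h i (blk_proj i u) - jac i (u + 0 *\<^sub>R d) d)
      \<le> (Lh * (norm d)\<^sup>2) / 2"
  proof (rule taylor_remainder_le_half[where E = "\<lambda>y. h i (blk_proj i y)" and D = "\<lambda>t. jac i (u + t *\<^sub>R d)"])
    fix t :: real assume t: "t \<in> {0..1}"
    have p[simp]: "blk_proj i (u + s *\<^sub>R d) = u + s *\<^sub>R d" for s
      by (simp add: blk_proj_add blk_proj_scaleR)
    show "((\<lambda>y. h i (blk_proj i y)) has_derivative jac i (u + t *\<^sub>R d)) (at (u + t *\<^sub>R d))"
      by (rule has_derivative_h[OF i]) (simp add: seg[OF t])
    have "onorm ((*v) (grad_h i (u + t *\<^sub>R d) - grad_h i (u + 0 *\<^sub>R d)))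
        \<le> L i * norm (u + t *\<^sub>R d - (u + 0 *\<^sub>R d))"
      by (rule h_grad_lipschitz[OF i seg[OF t] seg]) simp
    also have "\<dots> \<le> Lh * (t * norm d)"
      using t Max_consts(3)[OF i] by (simp add: mult_right_mono)
    finally have "norm (transpose (grad_h i (u + t *\<^sub>R d) - grad_h i (u + 0 *\<^sub>R d)) *v d) \<le> (Lh * (t * norm d)) * norm d"
      by (rule norm_transpose_mult_le)
    then show "norm (jac i (u + t *\<^sub>R d) d - jac i (u + 0 *\<^sub>R d) d) \<le> Lh * (norm d)\<^sup>2 * t"
      unfolding p by (simp only: transpose_mult_diff power2_eq_square mult_ac)
  qed
  moreover have "u + d = blk_proj i y"
    by (simp add: u_def d_def blk_proj_diff)
  ultimately show ?thesis
    by (simp add: u_def flip: d_def)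
qed

lemma f_remainder:
  assumes x: "x \<in> X" "y \<in> X"
  shows "\<bar>f y - f x - gradient f x \<bullet> (y - x)\<bar> \<le> Lf * (norm (y - x))\<^sup>2 / 2"
proof -
  define d where "d = y - x"
  have seg: "x + t *\<^sub>R d \<in> convex hull X" if "t \<in> {0..1}" for t
  proof -
    have "(1 - t) *\<^sub>R x + t *\<^sub>R y \<in> convex hull X"
      using that x by (intro convexD[OF convex_convex_hull] hull_inc) auto
    then show ?thesis
      by (simp add: d_def algebra_simps)
  qed
  have "norm (f (x + d) - f x - gradient f (x + 0 *\<^sub>R d) \<bullet> d) \<le> (Lf * (norm d)\<^sup>2) / 2"
  proof (rule taylor_remainder_le_half[where E = f and D = "\<lambda>t d'. gradient f (x + t *\<^sub>R d) \<bullet> d'"])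
    fix t :: real assume t: "t \<in> {0..1}"
    show "(f has_derivative (\<bullet>) (gradient f (x + t *\<^sub>R d))) (at (x + t *\<^sub>R d))"
      by (rule has_derivative_gradient[OF f_diff[OF seg[OF t]]])
    have "norm ((gradient f (x + t *\<^sub>R d) - gradient f (x + 0 *\<^sub>R d)) \<bullet> d)
        \<le> norm (gradient f (x + t *\<^sub>R d) - gradient f (x + 0 *\<^sub>R d)) * norm d"
      by (rule Cauchy_Schwarz_ineq2[folded real_norm_def])
    also have "\<dots> \<le> (Lf * norm (x + t *\<^sub>R d - (x + 0 *\<^sub>R d))) * norm d"
      by (intro mult_right_mono f_grad_lipschitz seg t) auto
    finally show "norm (gradient f (x + t *\<^sub>R d) \<bullet> d - gradient f (x + 0 *\<^sub>R d) \<bullet> d) \<le> Lf * (norm d)\<^sup>2 * t"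
      using t by (simp add: inner_diff_left power2_eq_square mult_ac)
  qed
  then show ?thesis by (simp add: d_def)
qed

lemma norm_hsum_le:
  assumes "x \<in> X"
  shows "norm (hsum x) \<le> Mh"
  unfolding hsum_def Mh_def
  by (intro sum_norm_le h_bound X_D[OF assms])

text \<open>Differentiating the penalty shifts the multiplier by
  \<open>\<rho> *\<^sub>R hsum x\<close>, which gives the block gradient the shape of the
  stationarity condition.\<close>

lemma blk_proj_gradient_K_fun:
  assumes x: "x \<in> X" and i: "i \<in> {1..p}"
  shows "blk_proj i (gradient (\<lambda>y. K_fun \<rho> y \<mu>) x)
    = blk_proj i (gradient f x) + grad_h i (blk_proj i x) *v (\<mu> + \<rho> *\<^sub>R hsum x)"
proof -
  have hull: "blk_proj j x \<in> convex hull Xi j" if "j \<in> {1..p}" for j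
    using X_D[OF x that] by (rule hull_inc)
  define A where "A d = (\<Sum>j=1..p. jac j x d)" for d
  have f: "(f has_derivative (\<lambda>d. gradient f x \<bullet> d)) (at x)"
    by (rule has_derivative_gradient[OF f_diff[OF hull_inc[OF x]]])
  have H: "(hsum has_derivative A) (at x)"
    unfolding hsum_def[abs_def] A_def
    by (rule has_derivative_sum) (rule has_derivative_h, auto intro: hull[simplified])
  have "((\<lambda>y. K_fun \<rho> y \<mu>) has_derivative (\<lambda>d. gradient f x \<bullet> d + \<mu> \<bullet> A d + \<rho> * (hsum x \<bullet> A d))) (at x)"
    unfolding K_fun_def[abs_def] power2_norm_eq_inner
    by (rule has_derivative_eq_rhs, (rule f H derivative_intros)+)
       (auto simp: fun_eq_iff inner_commute algebra_simps)
  then have grad: "gradient (\<lambda>y. K_fun \<rho> y \<mu>) x \<bullet> d = gradient f x \<bullet> d + \<mu> \<bullet> A d + \<rho> * (hsum x \<bullet> A d)" for d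
    by (rule has_derivative_imp_gradient_inner)
  \<comment> \<open>The derivative of \<open>h j\<close> sees block \<open>j\<close> only, so a
    direction supported on block \<open>i\<close> keeps a single summand.\<close>
  have A: "A (blk_proj i d) = jac i x d" for d
  proof -
    have "jac j x (blk_proj i d) = (if j = i then jac i x d else 0)" if j: "j \<in> {1..p}" for j
      using has_derivative_h(2)[OF j hull[OF j], of "blk_proj i d"]
        has_derivative_h(2)[OF i hull[OF i], of d]
      by (auto simp: blk_proj_blk_proj)
    then have "A (blk_proj i d) = (\<Sum>j=1..p. if j = i then jac i x d else 0)"
      unfolding A_def by (intro sum.cong refl)
    then show ?thesis
      using i by simp
  qed
  have "blk_proj i (gradient (\<lambda>y. K_fun \<rho> y \<mu>) x) \<bullet> d
      = (blk_proj i (gradient f x) + grad_h i (blk_proj i x) *v (\<mu> + \<rho> *\<^sub>R hsum x)) \<bullet> d" for d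
    by (simp add: blk_proj_inner grad A inner_add_left inner_grad_h)
  then show ?thesis
    using vector_eq_rdot by blast
qed

text \<open>The squared constraint term is expanded around the mean of its two endpoint values of \<open>hsum\<close>,
  so that only bounds at points of the (possibly nonconvex) domain enter.\<close>

lemma K_fun_block_descent:
  assumes x: "x \<in> X" "y \<in> X" and i: "i \<in> {1..p}" and y: "y = x + blk_proj i d" and \<rho>: "0 \<le> \<rho>"
  shows "K_fun \<rho> y \<mu> \<le> K_fun \<rho> x \<mu> + blk_proj i (gradient (\<lambda>y. K_fun \<rho> y \<mu>) x) \<bullet> blk_proj i d
      + Lip \<mu> \<rho> / 2 * (norm (blk_proj i d))\<^sup>2"
proof -
  define e where "e = blk_proj i d"
  have pj: "blk_proj j y = (if j = i then blk_proj i x + e else blk_proj j x)" for j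
    by (simp add: y e_def blk_proj_add blk_proj_blk_proj)
  have e [simp]: "blk_proj i (y - x) = e" "y - x = e" "blk_proj i e = e"
    by (simp_all add: y e_def)
  define a where "a = jac i x e"
  define \<delta> where "\<delta> = h i (blk_proj i y) - h i (blk_proj i x)"
  have hs: "hsum y = hsum x + \<delta>"
  proof -
    have "hsum y - hsum x = (\<Sum>j=1..p. if j = i then \<delta> else 0)"
      unfolding hsum_def \<delta>_def sum_subtractf[symmetric] by (rule sum.cong) (auto simp: pj)
    then show ?thesis using i by (simp add: algebra_simps)
  qed
  have Xi: "blk_proj i x \<in> Xi i" "blk_proj i y \<in> Xi i"
    using X_D x i by auto
  have rem: "norm (\<delta> - a) \<le> Lh * (norm e)\<^sup>2 / 2"
    using h_remainder[OF i Xi] by (simp add: \<delta>_def a_def)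
  have nf: "f y \<le> f x + gradient f x \<bullet> e + Lf * (norm e)\<^sup>2 / 2"
    using f_remainder[OF x] unfolding e(2) by linarith
  have n\<mu>: "\<mu> \<bullet> (\<delta> - a) \<le> norm \<mu> * (Lh * (norm e)\<^sup>2 / 2)"
    using norm_cauchy_schwarz[of \<mu> "\<delta> - a"] mult_left_mono[OF rem, of "norm \<mu>"] by simp
  have nm: "((1 / 2) *\<^sub>R (hsum x + hsum y)) \<bullet> (\<delta> - a) \<le> Mh * (Lh * (norm e)\<^sup>2 / 2)"
  proof -
    have "norm (hsum x + hsum y) \<le> Mh + Mh"
      using norm_hsum_le x by (intro norm_triangle_mono) auto
    then have "norm ((1 / 2) *\<^sub>R (hsum x + hsum y)) \<le> Mh" by simp
    then have "norm ((1 / 2) *\<^sub>R (hsum x + hsum y)) * norm (\<delta> - a) \<le> Mh * (Lh * (norm e)\<^sup>2 / 2)"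
      using rem by (rule mult_mono) (use consts_pos in auto)
    then show ?thesis using norm_cauchy_schwarz order_trans by blast
  qed
  have nd: "\<delta> \<bullet> a \<le> Kh * Jh * (norm e)\<^sup>2"
  proof -
    have "norm \<delta> \<le> K i * norm (blk_proj i y - blk_proj i x)"
      unfolding \<delta>_def by (rule h_lipschitz[OF i Xi(2,1)])
    also have "\<dots> \<le> Kh * norm e"
      using Max_consts[OF i] by (simp add: mult_right_mono flip: blk_proj_diff)
    finally have 1: "norm \<delta> \<le> Kh * norm e" .
    have "norm a \<le> J i * norm e"
      unfolding a_def by (rule norm_transpose_mult_le[OF h_grad_bound[OF i Xi(1)]])
    also have "\<dots> \<le> Jh * norm e"
      using Max_consts[OF i] by (simp add: mult_right_mono)
    finally have 2: "norm a \<le> Jh * norm e" .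
    have "\<delta> \<bullet> a \<le> norm \<delta> * norm a" by (rule norm_cauchy_schwarz)
    also have "\<dots> \<le> (Kh * norm e) * (Jh * norm e)"
      using 1 2 by (rule mult_mono) (use consts_pos in auto)
    finally show ?thesis by (simp add: power2_eq_square mult_ac)
  qed
  have grad: "blk_proj i (gradient (\<lambda>y. K_fun \<rho> y \<mu>) x) \<bullet> e
      = gradient f x \<bullet> e + \<mu> \<bullet> a + \<rho> * (hsum x \<bullet> a)"
    unfolding blk_proj_gradient_K_fun[OF x(1) i]
    by (simp add: inner_add_left blk_proj_inner[of i _ e] inner_grad_h a_def)
  \<comment> \<open>Half the difference of the squares is the mean of the two \<open>hsum\<close>
    values paired with \<open>\<delta>\<close>. Splitting \<open>\<delta>\<close> into
    \<open>a\<close> and a remainder leaves \<open>\<delta> \<bullet> a / 2\<close>, charged to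
    \<open>Jh * Kh\<close>, and a remainder term, charged to \<open>Mh * Lh\<close>.\<close>
  have sq: "(norm (hsum y))\<^sup>2 / 2 = (norm (hsum x))\<^sup>2 / 2 + hsum x \<bullet> a
      + ((1 / 2) *\<^sub>R (hsum x + hsum y)) \<bullet> (\<delta> - a) + \<delta> \<bullet> a / 2"
    unfolding hs power2_norm_eq_inner by (simp add: algebra_simps inner_commute)
  also have "\<dots> \<le> (norm (hsum x))\<^sup>2 / 2 + hsum x \<bullet> a + (Jh * Kh + Mh * Lh) * (norm e)\<^sup>2 / 2"
  proof -
    have "(Jh * Kh + Mh * Lh) * (norm e)\<^sup>2 / 2 = Kh * Jh * (norm e)\<^sup>2 / 2 + Mh * (Lh * (norm e)\<^sup>2 / 2)"
      by (simp add: field_simps)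
    then show ?thesis using nm nd by linarith
  qed
  finally have "\<rho> * ((norm (hsum y))\<^sup>2 / 2)
      \<le> \<rho> * ((norm (hsum x))\<^sup>2 / 2 + hsum x \<bullet> a + (Jh * Kh + Mh * Lh) * (norm e)\<^sup>2 / 2)"
    using \<rho> by (rule mult_left_mono)
  moreover have "\<mu> \<bullet> hsum y = \<mu> \<bullet> hsum x + \<mu> \<bullet> a + \<mu> \<bullet> (\<delta> - a)"
    by (simp add: hs inner_add_right inner_diff_right)
  moreover have "Lip \<mu> \<rho> / 2 * (norm e)\<^sup>2 = Lf * (norm e)\<^sup>2 / 2 + norm \<mu> * (Lh * (norm e)\<^sup>2 / 2)
      + \<rho> * ((Jh * Kh + Mh * Lh) * (norm e)\<^sup>2 / 2)"
    by (simp add: Lip_def field_simps)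
  ultimately show ?thesis
    unfolding e_def[symmetric] grad using nf n\<mu> unfolding K_fun_def distrib_left times_divide_eq_left times_divide_eq_right
    by linarith
qed


section \<open>The potential function\<close>

text \<open>With \<open>potential\<close>, a real-valued counterpart of \<open>gsum\<close> and
  \<open>P_fun\<close> that agrees with them on \<open>X\<close>, so that the descent estimates live
  in the reals.\<close>

definition gr :: "real^'n \<Rightarrow> real" where
  "gr x = (\<Sum>i=1..p. real_of_ereal (g i (blk_proj i x)))"

definition potential :: "real \<Rightarrow> real \<Rightarrow> real^'n \<Rightarrow> real^'m \<Rightarrow> real" where
  "potential \<rho> \<omega> x \<mu> = K_fun \<rho> x \<mu> + gr x + \<omega> / (2 * \<rho>) * (norm \<mu>)\<^sup>2"

lemma g_finite:
  assumes "i \<in> {1..p}" "v \<in> Xi i"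
  shows "\<bar>g i v\<bar> \<noteq> \<infinity>"
  using g_proper[OF assms(1)] assms(2) by (auto simp: proper_on_def Xi_def)

lemma gsum_eq_gr:
  assumes "x \<in> X"
  shows "gsum x = ereal (gr x)"
proof -
  have "gsum x = (\<Sum>i=1..p. ereal (real_of_ereal (g i (blk_proj i x))))"
    unfolding gsum_def by (intro sum.cong refl) (simp add: ereal_real' g_finite X_D[OF assms])
  then show ?thesis by (simp add: gr_def)
qed

lemma P_fun_eq_potential: "x \<in> X \<Longrightarrow> P_fun \<rho> \<omega> x \<mu> = ereal (potential \<rho> \<omega> x \<mu>)"
  by (simp add: P_fun_def potential_def gsum_eq_gr)

text \<open>One feasible value lies between \<open>P_inf\<close> and \<open>P_sup\<close>, so both
  are real and \<open>real_of_ereal\<close> of their difference splits.\<close>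

lemma objective_bounds:
  assumes x: "x \<in> X"
  shows "real_of_ereal P_inf \<le> f x + gr x" "f x + gr x \<le> real_of_ereal P_sup"
    and "Delta = real_of_ereal P_sup - real_of_ereal P_inf + C / 2"
proof -
  have le: "P_inf \<le> ereal (f x + gr x)" "ereal (f x + gr x) \<le> P_sup"
    unfolding P_inf_def P_sup_def using x gsum_eq_gr[OF x]
    by (auto intro!: INF_lower2[of x] SUP_upper2[of x])
  obtain l where l: "P_inf = ereal l"
    using le P_inf_finite by (cases P_inf) auto
  obtain u where u: "P_sup = ereal u"
    using le P_sup_finite by (cases P_sup) auto
  show "real_of_ereal P_inf \<le> f x + gr x" "f x + gr x \<le> real_of_ereal P_sup"
      "Delta = real_of_ereal P_sup - real_of_ereal P_inf + C / 2"
    using le by (simp_all add: l u Delta_def)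
qed

lemma Delta_nonneg: "0 \<le> Delta"
proof -
  obtain x where "x \<in> X" using initial_point[of 1] by auto
  from objective_bounds[OF this] C_nonneg show ?thesis by linarith
qed

lemma kappa2_pos: "0 < kappa2"
  unfolding kappa2_def using kappa1_pos consts_pos Delta_nonneg
  by (intro add_nonneg_pos add_nonneg_nonneg) auto

text \<open>As \<open>\<omega> \<ge> 4\<close>, the dual term holds at least two copies of
  \<open>(norm \<mu>)\<^sup>2 / \<rho>\<close>. One copy and half of the penalty complete the square
  with the coupling term; the other copy and the other half remain.\<close>

lemma potential_lower_bound:
  assumes x: "x \<in> X" and \<rho>: "0 < \<rho>" and \<omega>: "4 \<le> \<omega>"
  shows "real_of_ereal P_inf + \<rho> / 4 * (norm (hsum x))\<^sup>2 + (norm \<mu>)\<^sup>2 / \<rho> \<le> potential \<rho> \<omega> x \<mu>"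
proof -
  have "0 \<le> (norm (\<mu> + (\<rho> / 2) *\<^sub>R hsum x))\<^sup>2 / \<rho>"
    using \<rho> by simp
  also have "\<dots> = (norm \<mu>)\<^sup>2 / \<rho> + \<mu> \<bullet> hsum x + \<rho> / 4 * (norm (hsum x))\<^sup>2"
    using \<rho> unfolding power2_norm_eq_inner
    by (simp add: inner_add_left inner_add_right inner_commute[of "hsum x" \<mu>] field_simps)
  finally have 1: "0 \<le> (norm \<mu>)\<^sup>2 / \<rho> + \<mu> \<bullet> hsum x + \<rho> / 4 * (norm (hsum x))\<^sup>2" .
  have "4 / (2 * \<rho>) * (norm \<mu>)\<^sup>2 \<le> \<omega> / (2 * \<rho>) * (norm \<mu>)\<^sup>2"
    using \<rho> \<omega> by (intro mult_right_mono divide_right_mono) auto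
  then have 2: "2 * ((norm \<mu>)\<^sup>2 / \<rho>) \<le> \<omega> / (2 * \<rho>) * (norm \<mu>)\<^sup>2"
    by simp
  show ?thesis
    using objective_bounds(1)[OF x] 1 2 unfolding potential_def K_fun_def by simp
qed

lemma Lip_ge: "\<rho> * kappa1 \<le> Lip \<mu> \<rho>"
  unfolding Lip_def kappa1_def using Lf_pos consts_pos by simp

section \<open>The iteration\<close>

context
  fixes \<rho> \<omega> \<theta> \<tau> :: real and x :: "nat \<Rightarrow> real^'n" and \<mu> :: "nat \<Rightarrow> real^'m"
  assumes run: "sdd_admm (x 0) \<rho> \<omega> \<theta> \<tau> x \<mu>"
    and x0: "x 0 \<in> X" "(norm (hsum (x 0)))\<^sup>2 \<le> C / \<rho>"
    and \<rho>: "1 \<le> \<rho>" "Lf \<le> \<rho>" and \<omega>: "4 \<le> \<omega>" and \<theta>: "1 < \<theta>" and \<tau>: "0 \<le> \<tau>"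
begin

section \<open>Feasibility and descent along a run\<close>

abbreviation block_gradient :: "nat \<Rightarrow> nat \<Rightarrow> real^'n" where
  "block_gradient k i \<equiv>
     blk_proj i (gradient (\<lambda>y. K_fun \<rho> y (\<mu> k)) (mixed i (x (Suc k)) (x k)))"

lemma block_step:
  assumes "i \<in> {1..p}"
  shows "is_arg_min
      (\<lambda>v. g i v + ereal (block_gradient k i \<bullet> (v - blk_proj i (x k))
                          + \<theta> * Lip (\<mu> k) \<rho> / 2 * (norm (v - blk_proj i (x k)))\<^sup>2))
      (\<lambda>v. v \<in> blk_space i) (blk_proj i (x (Suc k)))"
  using run assms unfolding sdd_admm_def by blast

text \<open>The minimizer is compared with the old block, at which the linear and quadratic terms
  vanish.\<close>

lemma block_step_le:
  assumes "i \<in> {1..p}"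
  shows "g i (blk_proj i (x (Suc k)))
      + ereal (block_gradient k i \<bullet> blk_proj i (x (Suc k) - x k)
               + \<theta> * Lip (\<mu> k) \<rho> / 2 * (norm (blk_proj i (x (Suc k) - x k)))\<^sup>2)
      \<le> g i (blk_proj i (x k))"
proof -
  have "\<not> g i (blk_proj i (x k)) + ereal 0
      < g i (blk_proj i (x (Suc k)))
      + ereal (block_gradient k i \<bullet> blk_proj i (x (Suc k) - x k)
               + \<theta> * Lip (\<mu> k) \<rho> / 2 * (norm (blk_proj i (x (Suc k) - x k)))\<^sup>2)"
    using block_step[OF assms, of k] unfolding is_arg_min_def
    by (auto dest!: spec[of _ "blk_proj i (x k)"] simp: blk_proj_diff)
  then show ?thesis by (simp add: not_less)
qed

text \<open>By \<open>block_step_le\<close>, the new value of \<open>g i\<close> plus a real number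
  is at most the finite old value, so the new block lies in the effective domain.\<close>

lemma iterate_in_X: "x k \<in> X"
proof (induction k)
  case 0
  show ?case by (rule x0)
next
  case (Suc k)
  have "blk_proj i (x (Suc k)) \<in> Xi i" if i: "i \<in> {1..p}" for i
    using block_step_le[OF i, of k] X_D[OF Suc i] by (auto simp: Xi_def)
  then show ?case by (simp add: X_def)
qed

text \<open>Each gradient is taken at the current partially updated point, so the linear terms of
  the model and of \<open>K_fun_block_descent\<close> cancel. The proximal term offers
  \<open>\<theta>\<close> times the quadratic cost, leaving the factor \<open>\<theta> - 1\<close>;
  summation over the blocks telescopes.\<close>

lemma primal_descent:
  "K_fun \<rho> (x (Suc k)) (\<mu> k) + gr (x (Suc k)) + (\<theta> - 1) * Lip (\<mu> k) \<rho> / 2 * (norm (x (Suc k) - x k))\<^sup>2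
     \<le> K_fun \<rho> (x k) (\<mu> k) + gr (x k)"
proof -
  define z where "z i = mixed i (x (Suc k)) (x k)" for i
  define d where "d i = blk_proj i (x (Suc k) - x k)" for i
  define \<gamma> where "\<gamma> j i = real_of_ereal (g i (blk_proj i (x j)))" for j i
  define c where "c = (\<theta> - 1) * Lip (\<mu> k) \<rho> / 2"
  have z: "z i \<in> X" for i
    unfolding z_def by (intro mixed_in_X iterate_in_X)
  have step: "K_fun \<rho> (z (Suc i)) (\<mu> k) - K_fun \<rho> (z i) (\<mu> k) \<le> \<gamma> k i - \<gamma> (Suc k) i - c * (norm (d i))\<^sup>2"
    if i: "i \<in> {1..p}" for i
  proof -
    have g: "g i (blk_proj i (x j)) = ereal (\<gamma> j i)" for j
      unfolding \<gamma>_def by (simp add: ereal_real' g_finite[OF i X_D[OF iterate_in_X i]])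
    have "K_fun \<rho> (z (Suc i)) (\<mu> k) \<le> K_fun \<rho> (z i) (\<mu> k) + block_gradient k i \<bullet> d i
        + Lip (\<mu> k) \<rho> / 2 * (norm (d i))\<^sup>2"
      using K_fun_block_descent[OF z[of i] z[of "Suc i"] i, of "x (Suc k) - x k" \<rho> "\<mu> k"] \<rho>
      by (simp add: z_def d_def mixed_Suc)
    moreover have "\<gamma> (Suc k) i + (block_gradient k i \<bullet> d i + \<theta> * Lip (\<mu> k) \<rho> / 2 * (norm (d i))\<^sup>2) \<le> \<gamma> k i"
      using block_step_le[OF i, of k] unfolding g by (simp add: d_def)
    moreover have "c * (norm (d i))\<^sup>2 = \<theta> * Lip (\<mu> k) \<rho> / 2 * (norm (d i))\<^sup>2 - Lip (\<mu> k) \<rho> / 2 * (norm (d i))\<^sup>2"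
      by (simp add: c_def field_simps)
    ultimately show ?thesis by linarith
  qed
  have "(\<Sum>i=1..p. K_fun \<rho> (z (Suc i)) (\<mu> k) - K_fun \<rho> (z i) (\<mu> k))
      \<le> (\<Sum>i=1..p. \<gamma> k i - \<gamma> (Suc k) i - c * (norm (d i))\<^sup>2)"
    by (rule sum_mono[OF step])
  also have "\<dots> = gr (x k) - gr (x (Suc k)) - c * (norm (x (Suc k) - x k))\<^sup>2"
    unfolding sum_subtractf sum_distrib_left[symmetric] d_def sum_norm_blk_proj_sq \<gamma>_def gr_def ..
  also have "(\<Sum>i=1..p. K_fun \<rho> (z (Suc i)) (\<mu> k) - K_fun \<rho> (z i) (\<mu> k))
      = K_fun \<rho> (x (Suc k)) (\<mu> k) - K_fun \<rho> (x k) (\<mu> k)"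
    using sum_Suc_diff[of 1 p "\<lambda>i. K_fun \<rho> (z i) (\<mu> k)"] mixed_first mixed_last
    by (simp only: z_def)
  finally show ?thesis
    by (simp add: c_def)
qed

text \<open>The multiplier step minimizes in \<open>\<mu>\<close> instead of ascending, so
  comparison with the old multiplier shows that it cannot undo the primal descent.\<close>

lemma potential_descent:
  "potential \<rho> \<omega> (x (Suc k)) (\<mu> (Suc k)) + (\<theta> - 1) * \<rho> * kappa1 / 2 * (norm (x (Suc k) - x k))\<^sup>2
     \<le> potential \<rho> \<omega> (x k) (\<mu> k)"
proof -
  have "\<not> P_fun \<rho> \<omega> (x (Suc k)) (\<mu> k) + ereal (\<tau> * \<omega> / (2 * \<rho>) * (norm (\<mu> k - \<mu> k))\<^sup>2)
      < P_fun \<rho> \<omega> (x (Suc k)) (\<mu> (Suc k)) + ereal (\<tau> * \<omega> / (2 * \<rho>) * (norm (\<mu> (Suc k) - \<mu> k))\<^sup>2)"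
    using run unfolding sdd_admm_def is_arg_min_def by blast
  then have "potential \<rho> \<omega> (x (Suc k)) (\<mu> (Suc k)) + \<tau> * \<omega> / (2 * \<rho>) * (norm (\<mu> (Suc k) - \<mu> k))\<^sup>2
      \<le> potential \<rho> \<omega> (x (Suc k)) (\<mu> k)"
    by (simp add: P_fun_eq_potential iterate_in_X)
  moreover have "0 \<le> \<tau> * \<omega> / (2 * \<rho>) * (norm (\<mu> (Suc k) - \<mu> k))\<^sup>2"
    using \<tau> \<omega> \<rho> by simp
  moreover have "(\<theta> - 1) * (\<rho> * kappa1) / 2 * (norm (x (Suc k) - x k))\<^sup>2
      \<le> (\<theta> - 1) * Lip (\<mu> k) \<rho> / 2 * (norm (x (Suc k) - x k))\<^sup>2"
    using \<theta> Lip_ge by (intro mult_right_mono divide_right_mono mult_left_mono) auto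
  ultimately show ?thesis
    using primal_descent[of k] unfolding potential_def by (simp add: mult.assoc)
qed

text \<open>The one-step descents telescope. At the start \<open>\<mu> 0 = 0\<close>, and the
  penalty is at most \<open>C / 2\<close> by the choice of \<open>x 0\<close>; this explains the
  summand \<open>C / 2\<close> of \<open>Delta\<close>.\<close>

lemma total_descent:
  "\<rho> / 4 * (norm (hsum (x N)))\<^sup>2 + (norm (\<mu> N))\<^sup>2 / \<rho>
     + (\<theta> - 1) * \<rho> * kappa1 / 2 * (\<Sum>k<N. (norm (x (Suc k) - x k))\<^sup>2) \<le> Delta"
proof -
  have "potential \<rho> \<omega> (x N) (\<mu> N) + (\<theta> - 1) * \<rho> * kappa1 / 2 * (\<Sum>k<N. (norm (x (Suc k) - x k))\<^sup>2)
      \<le> potential \<rho> \<omega> (x 0) (\<mu> 0)"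
  proof (induction N)
    case (Suc N)
    then show ?case
      using potential_descent[of N] unfolding sum.lessThan_Suc distrib_left by linarith
  qed simp
  moreover have "potential \<rho> \<omega> (x 0) (\<mu> 0) \<le> real_of_ereal P_sup + C / 2"
  proof -
    have "\<rho> * (norm (hsum (x 0)))\<^sup>2 \<le> C"
      using x0(2) \<rho> by (simp add: field_simps)
    moreover have "\<mu> 0 = 0"
      using run by (simp add: sdd_admm_def)
    ultimately show ?thesis
      using objective_bounds(2)[OF x0(1)] by (simp add: potential_def K_fun_def)
  qed
  moreover have "real_of_ereal P_inf + \<rho> / 4 * (norm (hsum (x N)))\<^sup>2 + (norm (\<mu> N))\<^sup>2 / \<rho>
      \<le> potential \<rho> \<omega> (x N) (\<mu> N)"
    using \<rho> \<omega> by (intro potential_lower_bound iterate_in_X) auto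
  ultimately show ?thesis
    using objective_bounds(3)[OF x0(1)] by linarith
qed

lemma descent_coeff_pos: "0 < (\<theta> - 1) * \<rho> * kappa1 / 2"
  using \<theta> \<rho> kappa1_pos by simp

lemma hsum_and_multiplier_bound:
  "\<rho> / 4 * (norm (hsum (x N)))\<^sup>2 \<le> Delta" "(norm (\<mu> N))\<^sup>2 / \<rho> \<le> Delta"
proof -
  have "0 \<le> (\<theta> - 1) * \<rho> * kappa1 / 2 * (\<Sum>k<N. (norm (x (Suc k) - x k))\<^sup>2)"
    using descent_coeff_pos by (intro mult_nonneg_nonneg sum_nonneg) auto
  moreover have "0 \<le> \<rho> / 4 * (norm (hsum (x N)))\<^sup>2" "0 \<le> (norm (\<mu> N))\<^sup>2 / \<rho>"
    using \<rho> by auto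
  ultimately show "\<rho> / 4 * (norm (hsum (x N)))\<^sup>2 \<le> Delta" "(norm (\<mu> N))\<^sup>2 / \<rho> \<le> Delta"
    using total_descent[of N] by linarith+
qed

text \<open>From \<open>\<rho> \<ge> 1\<close> the multiplier bound \<open>\<rho> * Delta\<close>
  for the squared norm weakens to \<open>\<rho>\<^sup>2 * Delta\<close>, so every term becomes
  linear in \<open>\<rho>\<close>. The summand 1 of \<open>kappa2\<close> accounts for
  \<open>Lf \<le> \<rho>\<close>.\<close>

lemma Lip_le: "Lip (\<mu> k) \<rho> \<le> \<rho> * kappa2"
proof -
  have "norm (\<mu> k) \<le> \<rho> * sqrt Delta"
  proof -
    have "(norm (\<mu> k))\<^sup>2 \<le> \<rho> * Delta"
      using hsum_and_multiplier_bound(2)[of k] \<rho> by (simp add: field_simps)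
    also have "\<dots> \<le> \<rho>\<^sup>2 * Delta"
      using \<rho> Delta_nonneg by (intro mult_right_mono) (auto simp: power2_eq_square)
    finally have "norm (\<mu> k) \<le> sqrt (\<rho>\<^sup>2 * Delta)"
      by (rule real_le_rsqrt)
    then show ?thesis using \<rho> by (simp add: real_sqrt_mult)
  qed
  then have "norm (\<mu> k) * Lh \<le> \<rho> * sqrt Delta * Lh"
    using consts_pos by (simp add: mult_right_mono)
  then show ?thesis
    unfolding Lip_def kappa2_def kappa1_def using \<rho> by (simp add: algebra_simps)
qed

section \<open>Stationarity residual after a sweep\<close>

text \<open>The algorithm uses the gradient at the partially updated point \<open>z\<close>,
  stationarity asks for the new iterate \<open>y\<close>. The change of \<open>hsum\<close> collects
  the steps of several blocks and costs \<open>sqrt p\<close>; the other terms are enlarged by this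
  factor so that the constants add up to \<open>Lip\<close>.\<close>

lemma block_gradient_error:
  assumes i: "i \<in> {1..p}"
  shows "norm (block_gradient k i
        - (blk_proj i (gradient f (x (Suc k)))
           + grad_h i (blk_proj i (x (Suc k))) *v (\<mu> k + \<rho> *\<^sub>R hsum (x (Suc k)))))
      \<le> sqrt p * Lip (\<mu> k) \<rho> * norm (x (Suc k) - x k)"
proof -
  define z where "z = mixed i (x (Suc k)) (x k)"
  define y where "y = x (Suc k)"
  define D where "D = norm (y - x k)"
  have X: "z \<in> X" "y \<in> X" "x k \<in> X"
    by (auto simp: z_def y_def intro: mixed_in_X iterate_in_X)
  define A where "A = grad_h i (blk_proj i z)"
  define B where "B = grad_h i (blk_proj i y)"
  have p1: "1 \<le> sqrt p" using p_pos by simp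
  have "0 \<le> D" by (simp add: D_def)
  then have D: "D \<le> sqrt p * D" using p1 by (simp add: mult_le_cancel_right1)
  have 1: "norm (blk_proj i (gradient f z - gradient f y)) \<le> Lf * D"
  proof -
    have "norm (gradient f z - gradient f y) \<le> Lf * norm (z - y)"
      by (intro f_grad_lipschitz hull_inc X)
    also have "\<dots> \<le> Lf * D"
      unfolding D_def z_def y_def using Lf_pos norm_mixed_diff_le by (intro mult_left_mono) auto
    finally show ?thesis using norm_blk_proj_le order_trans by blast
  qed
  have bound: "norm (G *v u) \<le> c * norm u" if "onorm ((*v) G) \<le> c" for G :: "real^'m^'n" and u c
    using onorm[OF matrix_vector_mul_bounded_linear, of G u] mult_right_mono[OF that norm_ge_zero[of u]]
    by linarith
  have dAB: "onorm ((*v) (A - B)) \<le> Lh * D"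
  proof -
    have "onorm ((*v) (A - B)) \<le> L i * norm (blk_proj i z - blk_proj i y)"
      unfolding A_def B_def by (intro h_grad_lipschitz hull_inc X_D X i)
    also have "\<dots> \<le> Lh * norm (blk_proj i z - blk_proj i y)"
      using Max_consts[OF i] by (simp add: mult_right_mono)
    also have "blk_proj i z - blk_proj i y = blk_proj i (z - y)"
      by (simp add: blk_proj_diff)
    also have "Lh * norm (blk_proj i (z - y)) \<le> Lh * D"
      using norm_blk_proj_le[of i "z - y"] norm_mixed_diff_le[of i y "x k"] consts_pos
      unfolding D_def z_def y_def by (intro mult_left_mono) auto
    finally show ?thesis .
  qed
  have 2: "norm ((A - B) *v \<mu> k) \<le> norm (\<mu> k) * Lh * D"
    using bound[OF dAB, of "\<mu> k"] by (simp add: mult_ac)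
  have 3: "norm ((A - B) *v hsum z) \<le> Mh * Lh * D"
  proof -
    have "norm ((A - B) *v hsum z) \<le> Lh * D * norm (hsum z)"
      by (rule bound[OF dAB])
    also have "\<dots> \<le> Lh * D * Mh"
      using norm_hsum_le[OF X(1)] consts_pos by (intro mult_left_mono) (auto simp: D_def)
    finally show ?thesis by (simp add: mult_ac)
  qed
  have 4: "norm (B *v (hsum z - hsum y)) \<le> Jh * Kh * (sqrt p * D)"
  proof -
    \<comment> \<open>Blocks below \<open>i\<close> already agree with \<open>y\<close>; each of the
      others contributes its own step.\<close>
    have "norm (hsum z - hsum y) \<le> (\<Sum>j=1..p. Kh * norm (blk_proj j (y - x k)))"
      unfolding hsum_def sum_subtractf[symmetric]
    proof (rule sum_norm_le)
      fix j assume j: "j \<in> {1..p}"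
      have "norm (h j (blk_proj j z) - h j (blk_proj j y)) \<le> K j * norm (blk_proj j z - blk_proj j y)"
        by (intro h_lipschitz X_D X j)
      also have "\<dots> \<le> Kh * norm (blk_proj j (y - x k))"
        using Max_consts[OF j] consts_pos
        by (intro mult_mono) (auto simp: z_def y_def blk_proj_mixed blk_proj_diff norm_minus_commute)
      finally show "norm (h j (blk_proj j z) - h j (blk_proj j y)) \<le> Kh * norm (blk_proj j (y - x k))" .
    qed
    also have "\<dots> \<le> Kh * (sqrt p * D)"
      unfolding sum_distrib_left[symmetric] D_def
      using consts_pos by (intro mult_left_mono sum_norm_blk_proj_le) auto
    finally have hs: "norm (hsum z - hsum y) \<le> Kh * (sqrt p * D)" .
    have "onorm ((*v) B) \<le> J i"
      unfolding B_def by (intro h_grad_bound X_D X i)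
    then have "onorm ((*v) B) \<le> Jh"
      using Max_consts(2)[OF i] by linarith
    then have "norm (B *v (hsum z - hsum y)) \<le> Jh * norm (hsum z - hsum y)"
      by (rule bound)
    also have "\<dots> \<le> Jh * (Kh * (sqrt p * D))"
      using hs consts_pos by (intro mult_left_mono) auto
    finally show ?thesis by (simp add: mult_ac)
  qed
  \<comment> \<open>The product is split as \<open>(A - B) *v hsum z\<close> plus
    \<open>B *v (hsum z - hsum y)\<close>, matching the Lipschitz bound on the gradient and the one
    on the values.\<close>
  have eq: "block_gradient k i - (blk_proj i (gradient f y) + B *v (\<mu> k + \<rho> *\<^sub>R hsum y))
      = blk_proj i (gradient f z - gradient f y) + (A - B) *v \<mu> k
        + \<rho> *\<^sub>R ((A - B) *v hsum z) + \<rho> *\<^sub>R (B *v (hsum z - hsum y))"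
    using blk_proj_gradient_K_fun[OF X(1) i]
    by (simp add: z_def[symmetric] A_def[symmetric] blk_proj_diff matrix_vector_mult_diff_rdistrib
        matrix_vector_mult_diff_distrib matrix_vector_right_distrib matrix_vector_mult_scaleR
        algebra_simps)
  have "norm (block_gradient k i - (blk_proj i (gradient f y) + B *v (\<mu> k + \<rho> *\<^sub>R hsum y)))
      \<le> Lf * D + norm (\<mu> k) * Lh * D + \<rho> * (Mh * Lh * D) + \<rho> * (Jh * Kh * (sqrt p * D))"
    unfolding eq using \<rho> 1 2 3 4 by (intro norm_triangle_mono) (auto intro!: mult_left_mono)
  also have "\<dots> = (Lf + norm (\<mu> k) * Lh + \<rho> * (Mh * Lh)) * D + \<rho> * (Jh * Kh) * (sqrt p * D)"
    by (simp add: algebra_simps)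
  also have "\<dots> \<le> (Lf + norm (\<mu> k) * Lh + \<rho> * (Mh * Lh)) * (sqrt p * D) + \<rho> * (Jh * Kh) * (sqrt p * D)"
    using D Lf_pos consts_pos \<rho> by (intro add_right_mono mult_left_mono) auto
  also have "\<dots> = sqrt p * Lip (\<mu> k) \<rho> * D"
    by (simp add: Lip_def algebra_simps)
  finally show ?thesis
    unfolding B_def y_def D_def .
qed

lemma small_step_imp_eps_stationary:
  assumes \<epsilon>: "0 < \<epsilon>" "4 * Delta / \<epsilon>\<^sup>2 \<le> \<rho>"
    and small: "sqrt p * (\<theta> + 1) * \<rho> * kappa2 * norm (x (Suc k) - x k) \<le> \<epsilon>"
  shows "eps_stationary \<epsilon> (x (Suc k))"
proof -
  let ?y = "x (Suc k)"
  define D where "D = norm (?y - x k)"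
  \<comment> \<open>This is the multiplier in the gradient of \<open>K_fun\<close> at the new
    iterate with \<open>\<mu> k\<close> still in force, so \<open>block_gradient_error\<close>
    applies to it.\<close>
  define l where "l = \<mu> k + \<rho> *\<^sub>R hsum ?y"
  have "norm (hsum ?y) \<le> \<epsilon>"
  proof -
    have "\<rho> * (norm (hsum ?y))\<^sup>2 \<le> 4 * Delta"
      using hsum_and_multiplier_bound(1)[of "Suc k"] by simp
    also have "\<dots> \<le> \<rho> * \<epsilon>\<^sup>2"
      using \<epsilon> by (simp add: pos_divide_le_eq)
    finally have "(norm (hsum ?y))\<^sup>2 \<le> \<epsilon>\<^sup>2"
      using \<rho> by simp
    then show ?thesis
      by (rule power2_le_imp_le) (use \<epsilon> in simp)
  qed
  moreover have "set_dist (- blk_proj i (gradient f ?y) - grad_h i (blk_proj i ?y) *v l)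
      (limiting_subdiff (blk_space i) (g i) (blk_proj i ?y)) \<le> ereal \<epsilon>" if i: "i \<in> {1..p}" for i
  proof -
    define \<eta> where "\<eta> = \<theta> * Lip (\<mu> k) \<rho>"
    define w where "w = blk_proj i (gradient f ?y) + grad_h i (blk_proj i ?y) *v l"
    define v where "v = - block_gradient k i - \<eta> *\<^sub>R (blk_proj i ?y - blk_proj i (x k))"
    have "v \<in> regular_subdiff (blk_space i) (g i) (blk_proj i ?y)"
      unfolding v_def using block_step[OF i, of k] subspace_blk_space g_finite[OF i X_D[OF iterate_in_X i]]
      by (intro regular_subdiff_of_prox_min) (auto simp: \<eta>_def)
    then have "v \<in> limiting_subdiff (blk_space i) (g i) (blk_proj i ?y)"
      using regular_subdiff_subset_limiting by blast
    then have dist: "set_dist (- w) (limiting_subdiff (blk_space i) (g i) (blk_proj i ?y)) \<le> ereal (norm (v - - w))"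
      unfolding set_dist_def by (rule INF_lower)
    have "norm (v - - w) \<le> \<epsilon>"
    proof -
      have Lip0: "0 \<le> Lip (\<mu> k) \<rho>"
        using Lip_ge[of \<rho> "\<mu> k"] \<rho> kappa1_pos
        by (smt (verit) mult_nonneg_nonneg)
      have "v - - w = - ((block_gradient k i - w) + \<eta> *\<^sub>R blk_proj i (?y - x k))"
        by (simp add: v_def blk_proj_diff)
      then have "norm (v - - w) = norm ((block_gradient k i - w) + \<eta> *\<^sub>R blk_proj i (?y - x k))"
        by (metis norm_minus_cancel)
      also have "\<dots> \<le> sqrt p * Lip (\<mu> k) \<rho> * D + \<eta> * D"
      proof (rule norm_triangle_mono)
        show "norm (block_gradient k i - w) \<le> sqrt p * Lip (\<mu> k) \<rho> * D"
          using block_gradient_error[OF i, of k] by (simp add: w_def l_def D_def)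
        show "norm (\<eta> *\<^sub>R blk_proj i (?y - x k)) \<le> \<eta> * D"
          using Lip0 \<theta> by (auto simp: \<eta>_def D_def intro!: mult_left_mono norm_blk_proj_le)
      qed
      \<comment> \<open>The proximal contribution is enlarged by \<open>sqrt p\<close> as well, so
        that both parts merge into the factor \<open>\<theta> + 1\<close>.\<close>
      also have "\<dots> \<le> sqrt p * Lip (\<mu> k) \<rho> * D + sqrt p * (\<eta> * D)"
      proof -
        have "1 \<le> sqrt p" using p_pos by simp
        then have "1 * (\<eta> * D) \<le> sqrt p * (\<eta> * D)"
          using Lip0 \<theta> by (intro mult_right_mono) (auto simp: \<eta>_def D_def)
        then show ?thesis by simp
      qed
      also have "\<dots> = (sqrt p * (\<theta> + 1) * D) * Lip (\<mu> k) \<rho>"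
        by (simp add: \<eta>_def algebra_simps)
      also have "\<dots> \<le> (sqrt p * (\<theta> + 1) * D) * (\<rho> * kappa2)"
        using Lip_le \<theta> by (intro mult_left_mono) (auto simp: D_def)
      also have "\<dots> \<le> \<epsilon>"
        using small by (simp add: D_def mult_ac)
      finally show ?thesis .
    qed
    then have "ereal (norm (v - - w)) \<le> ereal \<epsilon>" by simp
    with dist show ?thesis
      unfolding w_def minus_add_distrib diff_conv_add_uminus[symmetric] by (rule order_trans)
  qed
  ultimately show ?thesis
    unfolding eps_stationary_def using iterate_in_X p_pos by (auto intro!: exI[of _ l])
qed

text \<open>If all \<open>N\<close> steps were longer than \<open>\<epsilon> / a\<close>, their
  squared sum would exceed the budget \<open>Delta / c\<close> from
  \<open>total_descent\<close>.\<close>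

lemma iteration_complexity:
  assumes \<epsilon>: "0 < \<epsilon>" "4 * Delta / \<epsilon>\<^sup>2 \<le> \<rho>"
  shows "\<exists>k\<le>iter_bound \<theta> \<epsilon> \<rho>. eps_stationary \<epsilon> (x k)"
proof -
  define N where "N = iter_bound \<theta> \<epsilon> \<rho>"
  define a where "a = sqrt p * (\<theta> + 1) * \<rho> * kappa2"
  define c where "c = (\<theta> - 1) * \<rho> * kappa1 / 2"
  have a: "0 < a" using p_pos \<theta> \<rho> kappa2_pos by (simp add: a_def)
  have c: "0 < c" using descent_coeff_pos by (simp add: c_def)
  have sum: "c * (\<Sum>k<n. (norm (x (Suc k) - x k))\<^sup>2) \<le> Delta" for n
  proof -
    have "0 \<le> \<rho> / 4 * (norm (hsum (x n)))\<^sup>2" "0 \<le> (norm (\<mu> n))\<^sup>2 / \<rho>"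
      using \<rho> by auto
    then show ?thesis using total_descent[of n] unfolding c_def by linarith
  qed
  \<comment> \<open>One factor \<open>\<rho>\<close> of \<open>a\<^sup>2\<close> cancels against the
    one in \<open>c\<close>, which leaves the bound linear in \<open>\<rho>\<close>.\<close>
  have "2 * real p * Delta * (\<theta> + 1)\<^sup>2 * kappa2\<^sup>2 * \<rho> / ((\<theta> - 1) * kappa1 * \<epsilon>\<^sup>2) = Delta * a\<^sup>2 / (c * \<epsilon>\<^sup>2)"
    using \<rho> \<theta> kappa1_pos \<epsilon> by (simp add: a_def c_def power_mult_distrib power2_eq_square[of \<rho>] mult_ac)
  then have "Delta * a\<^sup>2 / (c * \<epsilon>\<^sup>2) \<le> N"
    unfolding N_def iter_bound_def by linarith
  then have N: "Delta * a\<^sup>2 \<le> N * (c * \<epsilon>\<^sup>2)"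
    using c \<epsilon> by (simp add: pos_divide_le_eq)
  show ?thesis
  proof (cases "N = 0")
    case True
    then have "Delta * a\<^sup>2 \<le> 0" using N by simp
    then have "Delta \<le> 0" using a by (simp add: mult_le_0_iff)
    then have "c * (norm (x 1 - x 0))\<^sup>2 \<le> 0"
      using sum[of 1] by simp
    then have "x 1 = x 0" using c by (simp add: mult_le_0_iff)
    \<comment> \<open>The stationarity criterion speaks of successor iterates only, so
      \<open>x 0\<close> is reached through \<open>x 1\<close>.\<close>
    moreover have "eps_stationary \<epsilon> (x (Suc 0))"
      by (rule small_step_imp_eps_stationary[OF \<epsilon>]) (use \<open>x 1 = x 0\<close> \<epsilon> in simp)
    ultimately show ?thesis by auto
  next
    case False
    have "\<exists>k<N. a * norm (x (Suc k) - x k) \<le> \<epsilon>"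
    proof (rule ccontr)
      assume "\<not> ?thesis"
      then have *: "\<epsilon> < a * norm (x (Suc k) - x k)" if "k < N" for k
        using that by (auto simp: not_le)
      have "N * \<epsilon>\<^sup>2 = (\<Sum>k<N. \<epsilon>\<^sup>2)" by simp
      \<comment> \<open>Strictness requires a nonempty sum, hence the case distinction on
        \<open>N\<close>.\<close>
      also have "\<dots> < (\<Sum>k<N. (a * norm (x (Suc k) - x k))\<^sup>2)"
        using False * \<epsilon> by (intro sum_strict_mono power_strict_mono) auto
      also have "\<dots> = a\<^sup>2 * (\<Sum>k<N. (norm (x (Suc k) - x k))\<^sup>2)"
        by (simp add: power_mult_distrib sum_distrib_left)
      finally have "c * (N * \<epsilon>\<^sup>2) < a\<^sup>2 * (c * (\<Sum>k<N. (norm (x (Suc k) - x k))\<^sup>2))"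
        using c by (simp add: mult_ac)
      also have "\<dots> \<le> a\<^sup>2 * Delta"
        using sum[of N] by (intro mult_left_mono) auto
      finally show False using N by (simp add: mult_ac)
    qed
    then obtain k where "k < N" "a * norm (x (Suc k) - x k) \<le> \<epsilon>" by blast
    \<comment> \<open>A short step \<open>k < N\<close> certifies the iterate \<open>Suc k\<close>,
      whose index is still at most \<open>N\<close>.\<close>
    then show ?thesis
      using small_step_imp_eps_stationary[OF \<epsilon>, of k] unfolding N_def a_def
      by (metis Suc_leI)
  qed
qed

end

section \<open>Asymptotics of the iteration bound\<close>

text \<open>Rounding up costs at most 1, which is absorbed because
  \<open>\<rho> / \<epsilon>\<^sup>2 \<ge> 1\<close> in this range; hence the witness
  \<open>B + 1\<close>, which depends on neither \<open>\<epsilon>\<close> nor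
  \<open>\<rho>\<close>.\<close>

lemma iter_bound_le:
  assumes \<theta>: "1 < \<theta>"
  obtains A where "0 < A"
    and "\<And>\<epsilon> \<rho>. 0 < \<epsilon> \<Longrightarrow> \<epsilon> \<le> 1 \<Longrightarrow> 1 \<le> \<rho> \<Longrightarrow> real (iter_bound \<theta> \<epsilon> \<rho>) \<le> A * (\<rho> / \<epsilon>\<^sup>2)"
proof
  define B where "B = 2 * real p * Delta * (\<theta> + 1)\<^sup>2 * kappa2\<^sup>2 / ((\<theta> - 1) * kappa1)"
  have B: "0 \<le> B"
    unfolding B_def using \<theta> Delta_nonneg kappa1_pos by simp
  then show "0 < B + 1" by simp
  fix \<epsilon> \<rho> :: real assume \<epsilon>: "0 < \<epsilon>" "\<epsilon> \<le> 1" and \<rho>: "1 \<le> \<rho>"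
  have "\<epsilon>\<^sup>2 \<le> 1" using \<epsilon> by (simp add: power_le_one)
  then have 1: "1 \<le> \<rho> / \<epsilon>\<^sup>2" using \<epsilon> \<rho> by (simp add: pos_le_divide_eq)
  have eq: "iter_bound \<theta> \<epsilon> \<rho> = nat \<lceil>B * (\<rho> / \<epsilon>\<^sup>2)\<rceil>"
    by (simp add: iter_bound_def B_def mult_ac)
  have "0 \<le> B * (\<rho> / \<epsilon>\<^sup>2)" using B \<rho> by simp
  then have "real (iter_bound \<theta> \<epsilon> \<rho>) \<le> B * (\<rho> / \<epsilon>\<^sup>2) + 1"
    unfolding eq by linarith
  then show "real (iter_bound \<theta> \<epsilon> \<rho>) \<le> (B + 1) * (\<rho> / \<epsilon>\<^sup>2)"
    using 1 unfolding distrib_right by linarith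
qed

lemma rho_min_le_iff: "rho_min \<epsilon> \<le> \<rho> \<longleftrightarrow> 1 \<le> \<rho> \<and> Lf \<le> \<rho> \<and> 4 * Delta / \<epsilon>\<^sup>2 \<le> \<rho>"
  by (simp add: rho_min_def)

end

theorem theorem3p12:
  fixes p :: nat and blk :: "'n::finite \<Rightarrow> nat"
    and f :: "real^'n \<Rightarrow> real"
    and g :: "nat \<Rightarrow> real^'n \<Rightarrow> ereal"
    and h :: "nat \<Rightarrow> real^'n \<Rightarrow> real^('m::finite)"
    and Lf :: real and M K J L :: "nat \<Rightarrow> real" and C :: real
  assumes "sdd_problem p blk f g h Lf M K J L C"
  shows
    "(\<forall>\<epsilon>>0. \<forall>\<rho>\<ge>sdd_data.rho_min p blk f g Lf C \<epsilon>. \<forall>\<omega>\<ge>4. \<forall>\<theta>>1. \<forall>\<tau>\<ge>0.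
        \<forall>x0\<in>sdd_data.X p blk g. (norm (sdd_data.hsum p blk h x0))\<^sup>2 \<le> C / \<rho> \<longrightarrow>
        (\<forall>x \<mu>. sdd_data.sdd_admm p blk f g h Lf M K J L x0 \<rho> \<omega> \<theta> \<tau> x \<mu> \<longrightarrow>
           (\<exists>k\<le>sdd_data.iter_bound p blk f g M K J L C \<theta> \<epsilon> \<rho>.
              sdd_data.eps_stationary p blk f g h \<epsilon> (x k))))
     \<and> (\<forall>\<theta>>1. \<exists>A>0. \<forall>\<^sub>F \<epsilon> in at_right 0. \<forall>\<rho>\<ge>sdd_data.rho_min p blk f g Lf C \<epsilon>.
          real (sdd_data.iter_bound p blk f g M K J L C \<theta> \<epsilon> \<rho>) \<le> A * (\<rho> / \<epsilon>\<^sup>2))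
     \<and> (\<forall>\<theta>>1. \<forall>\<rho> :: real \<Rightarrow> real.
          (\<forall>\<^sub>F \<epsilon> in at_right 0. \<rho> \<epsilon> \<ge> sdd_data.rho_min p blk f g Lf C \<epsilon>) \<longrightarrow>
          \<rho> \<in> \<Theta>[at_right 0](\<lambda>\<epsilon>. 1 / \<epsilon>\<^sup>2) \<longrightarrow>
          (\<lambda>\<epsilon>. real (sdd_data.iter_bound p blk f g M K J L C \<theta> \<epsilon> (\<rho> \<epsilon>)))
            \<in> O[at_right 0](\<lambda>\<epsilon>. 1 / \<epsilon> ^ 4))"
proof -
  interpret sdd_problem p blk f g h Lf M K J L C by (rule assms)
  have ev: "\<forall>\<^sub>F \<epsilon> in at_right 0. 0 < \<epsilon> \<and> \<epsilon> \<le> (1::real)"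
    using eventually_at_right_real[of 0 "1::real"] by (auto elim: eventually_mono)
  show ?thesis
  proof (intro conjI allI impI ballI)
    fix \<epsilon> \<rho> \<omega> \<theta> \<tau> :: real and x0 x \<mu>
    assume as: "0 < \<epsilon>" "rho_min \<epsilon> \<le> \<rho>" "4 \<le> \<omega>" "1 < \<theta>" "0 \<le> \<tau>" "x0 \<in> X"
      "(norm (hsum x0))\<^sup>2 \<le> C / \<rho>" "sdd_admm x0 \<rho> \<omega> \<theta> \<tau> x \<mu>"
    have "x 0 = x0" using as(8) by (simp add: sdd_admm_def)
    then show "\<exists>k\<le>iter_bound \<theta> \<epsilon> \<rho>. eps_stationary \<epsilon> (x k)"
      using as by (intro iteration_complexity[of x \<rho> \<omega> \<theta> \<tau> \<mu> \<epsilon>]) (auto simp: rho_min_le_iff)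
  next
    fix \<theta> :: real assume "1 < \<theta>"
    then obtain A where A: "0 < A"
      "\<And>\<epsilon> \<rho>. 0 < \<epsilon> \<Longrightarrow> \<epsilon> \<le> 1 \<Longrightarrow> 1 \<le> \<rho> \<Longrightarrow> real (iter_bound \<theta> \<epsilon> \<rho>) \<le> A * (\<rho> / \<epsilon>\<^sup>2)"
      by (rule iter_bound_le) blast
    show "\<exists>A>0. \<forall>\<^sub>F \<epsilon> in at_right 0. \<forall>\<rho>\<ge>rho_min \<epsilon>. real (iter_bound \<theta> \<epsilon> \<rho>) \<le> A * (\<rho> / \<epsilon>\<^sup>2)"
      using A(1) by (intro exI[of _ A] conjI eventually_mono[OF ev]) (auto simp: rho_min_le_iff simp del: times_divide_eq_right intro!: A(2))
  next
    fix \<theta> :: real and \<rho> :: "real \<Rightarrow> real"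
    assume "1 < \<theta>" and \<rho>: "\<forall>\<^sub>F \<epsilon> in at_right 0. rho_min \<epsilon> \<le> \<rho> \<epsilon>"
      and Th: "\<rho> \<in> \<Theta>[at_right 0](\<lambda>\<epsilon>. 1 / \<epsilon>\<^sup>2)"
    then obtain A where A: "0 < A"
      "\<And>\<epsilon> \<rho>. 0 < \<epsilon> \<Longrightarrow> \<epsilon> \<le> 1 \<Longrightarrow> 1 \<le> \<rho> \<Longrightarrow> real (iter_bound \<theta> \<epsilon> \<rho>) \<le> A * (\<rho> / \<epsilon>\<^sup>2)"
      using iter_bound_le by blast
    \<comment> \<open>Eventually \<open>\<rho> \<epsilon> \<ge> 1\<close>, so
      \<open>iter_bound_le\<close> applies pointwise and the norms are the values themselves. The
      order of \<open>\<rho>\<close> is inserted afterwards.\<close>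
    have "(\<lambda>\<epsilon>. real (iter_bound \<theta> \<epsilon> (\<rho> \<epsilon>))) \<in> O[at_right 0](\<lambda>\<epsilon>. \<rho> \<epsilon> * (1 / \<epsilon>\<^sup>2))"
    proof (rule bigoI[of _ A])
      show "\<forall>\<^sub>F \<epsilon> in at_right 0. norm (real (iter_bound \<theta> \<epsilon> (\<rho> \<epsilon>))) \<le> A * norm (\<rho> \<epsilon> * (1 / \<epsilon>\<^sup>2))"
        using ev \<rho>
      proof eventually_elim
        case (elim \<epsilon>)
        then show ?case using A(2)[of \<epsilon> "\<rho> \<epsilon>"] by (simp add: rho_min_le_iff)
      qed
    qed
    also have "(\<lambda>\<epsilon>. \<rho> \<epsilon> * (1 / \<epsilon>\<^sup>2)) \<in> O[at_right 0](\<lambda>\<epsilon>. 1 / \<epsilon>\<^sup>2 * (1 / \<epsilon>\<^sup>2))"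
      using Th by (intro landau_o.big.mult) auto
    also have "(\<lambda>\<epsilon>::real. 1 / \<epsilon>\<^sup>2 * (1 / \<epsilon>\<^sup>2)) = (\<lambda>\<epsilon>. 1 / \<epsilon> ^ 4)"
      by (simp add: fun_eq_iff flip: power_add)
    finally show "(\<lambda>\<epsilon>. real (iter_bound \<theta> \<epsilon> (\<rho> \<epsilon>))) \<in> O[at_right 0](\<lambda>\<epsilon>. 1 / \<epsilon> ^ 4)" .
  qed
qed

end
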